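(* Let $\delta$ be a positive even integer. Every $n$-vertex graph $G = (V,E)$ with $m$ edges and minimum degree at least $\delta$ has a bisection $V=V_1\cup V_2$ in which both $e(V_1)$ and $e(V_2)$ are at most $\left(\frac{\delta+2}{4(\delta+1)} + o(1)\right) m$. That is: for every $\varepsilon > 0$ and every positive even integer $\delta$ there exists $n_0$ such that every graph $G=(V,E)$ with $n \ge n_0$ vertices, $m$ edges, and minimum degree at least $\delta$ has a bisection $V = V_1 \cup V_2$ with $$e(V_i) \le \left(\frac{\delta+2}{4(\delta+1)} + \varepsilon\right) m \quad\text{for both } i=1,2.$$
   Context: Graphs are finite and simple. A bisection of a graph is a bipartition $V = V_1 \cup V_2$ of its vertex set into disjoint parts with $\big||V_1|-|V_2|\big| \le 1$. For a vertex set $U$, $e(U)$ is the number of edges with both endpoints in $U$. The $o(1)$ term tends to $0$ as $n \to \infty$, for fixed $\delta$. *)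

theory Defs
  imports Complex_Main
begin

(* Edges are two-element subsets of V, so loops and parallel edges are excluded
   and the number of edges is simply card E. *)
locale simple_graph =
  fixes V :: "'a set" and E :: "'a set set"
  assumes finite_vertices: "finite V"
    and edge_subset: "e \<in> E \<Longrightarrow> e \<subseteq> V"
    and edge_card: "e \<in> E \<Longrightarrow> card e = 2"

definition vertex_degree :: "'a set set \<Rightarrow> 'a \<Rightarrow> nat" where
  "vertex_degree E v = card {e \<in> E. v \<in> e}"

(* Only meaningful for nonempty finite V. *)
definition min_degree :: "'a set \<Rightarrow> 'a set set \<Rightarrow> nat" where
  "min_degree V E = Min (vertex_degree E ` V)"

definition edges_within :: "'a set set \<Rightarrow> 'a set \<Rightarrow> nat" where
  "edges_within E U = card {e \<in> E. e \<subseteq> U}"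

definition bisection :: "'a set \<Rightarrow> 'a set \<Rightarrow> 'a set \<Rightarrow> bool" where
  "bisection V V1 V2 \<longleftrightarrow>
     V1 \<union> V2 = V \<and> V1 \<inter> V2 = {} \<and> \<bar>int (card V1) - int (card V2)\<bar> \<le> 1"

end

theory Submission
  imports Defs
begin

text \<open>
  For a sign vector \<open>x\<close> on \<open>V\<close> the two sides span \<open>m / 4 \<plusminus> S / 4 + Q / 8\<close> edges, where
  \<open>S = (\<Sum>v. deg v * x v)\<close> and \<open>Q\<close> is the adjacency form at \<open>x\<close>. Partition the vertices into
  clusters with prescribed relative signs and flip the clusters independently. On average \<open>Q\<close> is
  its contribution from inside the clusters, while \<open>S\<close> and the imbalance of the sides are small
  if every cluster is. An almost balanced bipartition is repaired by moving a few vertices of low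
  degree. If \<open>m\<close> is much larger than \<open>n\<close>, singleton clusters already give \<open>m / 4 + o(m)\<close>.

  Otherwise the few vertices of linear degree form one cluster \<open>A\<close>, and \<open>B = V - A\<close> is
  partitioned into induced stars grown from a maximum matching, which save \<open>(|B| - |Z|) / 8\<close> edges
  per side. Here \<open>Z\<close> consists of the unmatched vertices that fit into no star; around them all
  degrees in \<open>B\<close> are even. The signs on \<open>A\<close> minimise the discrepancy \<open>\<theta>\<close> of the degrees into
  \<open>B\<close>, and a double count shows that \<open>\<theta> / 4\<close> exceeds the saving by at most \<open>m / (4 * (\<delta> + 1))\<close>.
  The parity of \<open>\<delta>\<close> enters in that count, through the even degrees around \<open>Z\<close>.
\<close>

subsection \<open>Random signs\<close>

text \<open>Under independent uniform signs the off-diagonal form has mean zero. Made deterministic: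
  a new index \<open>k\<close> adds \<open>e * r\<close>, where \<open>r\<close> is linear in the
  signs already fixed, and \<open>e\<close> is chosen opposite to \<open>r\<close>.\<close>

lemma quadratic_signs:
  fixes b :: "'k \<Rightarrow> 'k \<Rightarrow> real"
  assumes "finite K"
  shows "\<exists>s. (\<forall>k. s k = 1 \<or> s k = - 1) \<and> (\<Sum>i\<in>K. \<Sum>j\<in>K - {i}. b i j * s i * s j) \<le> 0"
  using assms
proof (induction K)
  case empty
  show ?case by (intro exI[of _ "\<lambda>_. 1"]) simp
next
  case (insert k K)
  then obtain s where s: "\<And>k. s k = 1 \<or> s k = - 1"
    and le: "(\<Sum>i\<in>K. \<Sum>j\<in>K - {i}. b i j * s i * s j) \<le> 0"
    by blast
  define r where "r = (\<Sum>j\<in>K. (b k j + b j k) * s j)"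
  define e :: real where "e = (if r \<le> 0 then 1 else - 1)"
  define s' where "s' = s(k := e)"
  have "(\<Sum>i\<in>insert k K. \<Sum>j\<in>insert k K - {i}. b i j * s' i * s' j)
      = (\<Sum>j\<in>K. b k j * e * s j)
        + (\<Sum>i\<in>K. b i k * s i * e + (\<Sum>j\<in>K - {i}. b i j * s i * s j))"
  proof -
    have "(\<Sum>j\<in>insert k K - {k}. b k j * s' k * s' j) = (\<Sum>j\<in>K. b k j * e * s j)"
      using insert.hyps by (intro sum.cong) (auto simp: s'_def)
    moreover have "(\<Sum>j\<in>insert k K - {i}. b i j * s' i * s' j)
        = b i k * s i * e + (\<Sum>j\<in>K - {i}. b i j * s i * s j)" if "i \<in> K" for i
    proof -
      have "insert k K - {i} = insert k (K - {i})" "i \<noteq> k"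
        using that insert.hyps by auto
      moreover have "(\<Sum>j\<in>K - {i}. b i j * s' i * s' j) = (\<Sum>j\<in>K - {i}. b i j * s i * s j)"
        using insert.hyps \<open>i \<noteq> k\<close> by (intro sum.cong) (auto simp: s'_def)
      ultimately show ?thesis
        using insert.hyps by (simp add: s'_def)
    qed
    ultimately show ?thesis
      using insert.hyps by simp
  qed
  also have "\<dots> = e * r + (\<Sum>i\<in>K. \<Sum>j\<in>K - {i}. b i j * s i * s j)"
    by (simp add: r_def sum.distrib sum_distrib_left algebra_simps)
  also have "\<dots> \<le> 0"
    using le by (simp add: e_def)
  finally show ?case
    using s by (intro exI[of _ s']) (auto simp: s'_def e_def)
qed

text \<open>
  Derandomised averaging: with an independent uniform sign for every cluster, the cross terms
  between distinct clusters have mean zero.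
\<close>

lemma cluster_signs:
  fixes q :: "'a \<Rightarrow> 'a \<Rightarrow> real" and c :: "'a \<Rightarrow> 'k"
  assumes "finite V"
  shows "\<exists>s. (\<forall>k. s k = 1 \<or> s k = - 1) \<and>
    (\<Sum>u\<in>V. \<Sum>v\<in>V. q u v * (h u * s (c u)) * (h v * s (c v)))
      \<le> (\<Sum>u\<in>V. \<Sum>v | v \<in> V \<and> c v = c u. q u v * h u * h v)"
proof -
  \<comment> \<open>As \<open>s\<close> is constant on clusters, the form collapses to one in the
    cluster signs with matrix \<open>b\<close>. Its diagonal survives unchanged because
    \<open>s k * s k = 1\<close>.\<close>
  define b where "b i j = (\<Sum>u | u \<in> V \<and> c u = i. \<Sum>v | v \<in> V \<and> c v = j. q u v * h u * h v)" for i j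
  obtain s :: "'k \<Rightarrow> real" where s: "\<And>k. s k = 1 \<or> s k = - 1"
    and le: "(\<Sum>i\<in>c ` V. \<Sum>j\<in>c ` V - {i}. b i j * s i * s j) \<le> 0"
    using quadratic_signs[of "c ` V" b] assms by auto
  have ss: "s k * s k = 1" for k
    using s[of k] by auto
  have inner: "(\<Sum>v\<in>V. q u v * (h u * s (c u)) * (h v * s (c v)))
      = (\<Sum>j\<in>c ` V. (\<Sum>v | v \<in> V \<and> c v = j. q u v * h u * h v) * s (c u) * s j)" for u
    using assms
    by (subst sum.image_gen[where g = c]) (auto simp: sum_distrib_right intro!: sum.cong)
  have "(\<Sum>u\<in>V. \<Sum>v\<in>V. q u v * (h u * s (c u)) * (h v * s (c v)))
      = (\<Sum>i\<in>c ` V. \<Sum>u | u \<in> V \<and> c u = i. \<Sum>j\<in>c ` V.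
          (\<Sum>v | v \<in> V \<and> c v = j. q u v * h u * h v) * s i * s j)"
    unfolding inner using assms
    by (subst sum.image_gen[where g = c]) (auto intro!: sum.cong)
  also have "\<dots> = (\<Sum>i\<in>c ` V. \<Sum>j\<in>c ` V. b i j * s i * s j)"
    by (intro sum.cong refl, subst sum.swap) (simp add: b_def sum_distrib_right)
  also have "\<dots> = (\<Sum>i\<in>c ` V. b i i) + (\<Sum>i\<in>c ` V. \<Sum>j\<in>c ` V - {i}. b i j * s i * s j)"
    unfolding sum.distrib[symmetric] using assms
    by (intro sum.cong) (auto simp: sum.remove mult.assoc ss)
  also have "\<dots> \<le> (\<Sum>i\<in>c ` V. b i i)"
    using le by simp
  also have "\<dots> = (\<Sum>u\<in>V. \<Sum>v | v \<in> V \<and> c v = c u. q u v * h u * h v)"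
    using assms unfolding b_def
    by (subst sum.image_gen[where g = c and S = V]) (auto intro!: sum.cong)
  finally show ?thesis
    using s by blast
qed

subsection \<open>Sign vectors on a graph\<close>

context simple_graph
begin

definition adj :: "'a \<Rightarrow> 'a \<Rightarrow> bool" where
  "adj u v \<longleftrightarrow> {u, v} \<in> E"

definition wt :: "'a \<Rightarrow> 'a \<Rightarrow> real" where
  "wt u v = (if adj u v then 1 else 0)"

definition deg :: "'a \<Rightarrow> real" where
  "deg v = real (vertex_degree E v)"

lemma adj_sym: "adj u v \<Longrightarrow> adj v u"
  by (simp add: adj_def insert_commute)

lemma adj_irrefl: "\<not> adj v v"
  using edge_card[of "{v}"] by (auto simp: adj_def)

lemma symp_adj: "symp adj"
  using adj_sym by (rule sympI)

lemma irreflp_adj: "irreflp adj"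
  using adj_irrefl by (rule irreflpI)

lemma wt_sym: "wt u v = wt v u"
  using adj_sym by (auto simp: wt_def)

lemma wt_nonneg: "0 \<le> wt u v"
  by (simp add: wt_def)

lemma finite_edges: "finite E"
  using finite_vertices edge_subset by (intro finite_subset[of E "Pow V"]) auto

lemma sum_wt: "finite U \<Longrightarrow> (\<Sum>u\<in>U. wt v u) = real (card {u \<in> U. adj v u})"
  by (simp add: wt_def sum.If_cases Int_def)

lemma vertex_degree_eq: "vertex_degree E v = card {u \<in> V. adj v u}"
proof -
  have "{e \<in> E. v \<in> e} = (\<lambda>u. {v, u}) ` {u \<in> V. adj v u}"
  proof (intro equalityI subsetI)
    fix e assume e: "e \<in> {e \<in> E. v \<in> e}"
    then obtain a b where "e = {a, b}"
      using edge_card by (metis (no_types, lifting) card_2_iff mem_Collect_eq)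
    with e obtain u where "e = {v, u}"
      by auto
    with e show "e \<in> (\<lambda>u. {v, u}) ` {u \<in> V. adj v u}"
      using edge_subset[of e] by (auto simp: adj_def)
  qed (auto simp: adj_def)
  moreover have "inj_on (\<lambda>u. {v, u}) {u \<in> V. adj v u}"
    by (auto simp: inj_on_def doubleton_eq_iff)
  ultimately show ?thesis
    by (simp add: vertex_degree_def card_image)
qed

lemma deg_eq: "deg v = (\<Sum>u\<in>V. wt v u)"
  using finite_vertices by (simp add: deg_def vertex_degree_eq sum_wt)

lemma deg_nonneg: "0 \<le> deg v"
  by (simp add: deg_def)

lemma deg_le: "deg v \<le> real (card V)"
  unfolding deg_def vertex_degree_eq using finite_vertices by (auto intro!: card_mono)

text \<open>Each edge inside \<open>U\<close> arises from exactly two ordered pairs.\<close>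

lemma edges_within_eq:
  assumes "U \<subseteq> V"
  shows "(\<Sum>u\<in>U. \<Sum>v\<in>U. wt u v) = 2 * real (edges_within E U)"
proof -
  define F where "F = {e \<in> E. e \<subseteq> U}"
  have fin: "finite U" "finite F"
    using assms finite_vertices finite_edges by (auto simp: F_def intro: finite_subset)
  have card2: "card {(u, v). {u, v} = e} = 2" "finite {(u, v). {u, v} = e}" if "e \<in> F" for e
  proof -
    have "card e = 2"
      using that edge_card by (auto simp: F_def)
    then obtain a b where "e = {a, b}" "a \<noteq> b"
      by (auto simp: card_2_iff)
    then have "{(u, v). {u, v} = e} = {(a, b), (b, a)}"
      by (auto simp: doubleton_eq_iff)
    then show "card {(u, v). {u, v} = e} = 2" "finite {(u, v). {u, v} = e}"
      using \<open>a \<noteq> b\<close> by auto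
  qed
  have "(\<Sum>u\<in>U. \<Sum>v\<in>U. wt u v) = real (\<Sum>u\<in>U. card {v \<in> U. adj u v})"
    by (simp add: sum_wt fin)
  also have "(\<Sum>u\<in>U. card {v \<in> U. adj u v}) = card (SIGMA u:U. {v \<in> U. adj u v})"
    using fin by simp
  also have "(SIGMA u:U. {v \<in> U. adj u v}) = (\<Union>e\<in>F. {(u, v). {u, v} = e})"
    by (auto simp: F_def adj_def)
  also have "card \<dots> = (\<Sum>e\<in>F. card {(u, v). {u, v} = e})"
    using fin card2 by (intro card_UN_disjoint) auto
  also have "\<dots> = 2 * edges_within E U"
    using card2 by (simp add: edges_within_def F_def)
  finally show ?thesis
    by simp
qed

lemma sum_deg: "(\<Sum>v\<in>V. deg v) = 2 * real (card E)"
proof -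
  have "edges_within E V = card E"
    using edge_subset by (auto simp: edges_within_def intro: arg_cong[where f = card])
  then show ?thesis
    using edges_within_eq[of V] by (simp add: deg_eq)
qed

text \<open>Lets errors proportional to the number of vertices be absorbed into multiples of the
  number of edges.\<close>

lemma card_vertices_le:
  assumes "\<And>v. v \<in> V \<Longrightarrow> 2 \<le> vertex_degree E v"
  shows "card V \<le> card E"
proof -
  have "(\<Sum>v\<in>V. 2) \<le> (\<Sum>v\<in>V. deg v)"
    using assms by (intro sum_mono) (force simp: deg_def)
  then show ?thesis
    by (simp add: sum_deg)
qed

text \<open>Expand the indicator of the side as \<open>(1 \<plusminus> x v) / 2\<close>.\<close>

lemma edges_within_sign:
  assumes x: "\<And>v. x v = 1 \<or> x v = - 1" and e: "e = 1 \<or> e = - 1"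
  shows "real (edges_within E {v \<in> V. x v = e})
    = real (card E) / 4 + e * (\<Sum>v\<in>V. deg v * x v) / 4
      + (\<Sum>u\<in>V. \<Sum>v\<in>V. wt u v * x u * x v) / 8"
proof -
  define g where "g v = (if x v = e then 1 else 0 :: real)" for v
  have g: "g v = (1 + e * x v) / 2" for v
    using x[of v] e by (auto simp: g_def)
  have ee: "e * e = 1"
    using e by auto
  have restr: "(\<Sum>v | v \<in> V \<and> x v = e. f v) = (\<Sum>v\<in>V. g v * f v)" for f
    using finite_vertices by (simp add: g_def sum.inter_filter if_distrib[of "\<lambda>z. z * _"] cong: if_cong)
  have "2 * real (edges_within E {v \<in> V. x v = e})
      = (\<Sum>u\<in>V. \<Sum>v\<in>V. g u * g v * wt u v)"
    by (subst edges_within_eq[symmetric]) (auto simp: restr sum_distrib_left mult.assoc)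
  also have "\<dots> = (\<Sum>u\<in>V. \<Sum>v\<in>V. wt u v / 4 + e * (wt u v * x u) / 4 + e * (wt u v * x v) / 4
      + wt u v * x u * x v / 4)"
  proof (intro sum.cong refl)
    fix u v
    have "g u * g v * wt u v = wt u v / 4 + e * (wt u v * x u) / 4 + e * (wt u v * x v) / 4
        + (e * e) * (wt u v * x u * x v) / 4"
      by (simp add: g field_simps)
    then show "g u * g v * wt u v = wt u v / 4 + e * (wt u v * x u) / 4 + e * (wt u v * x v) / 4
        + wt u v * x u * x v / 4"
      by (simp add: ee)
  qed
  also have "\<dots> = (\<Sum>u\<in>V. deg u) / 4 + e * (\<Sum>u\<in>V. deg u * x u) / 4
      + e * (\<Sum>u\<in>V. \<Sum>v\<in>V. wt u v * x v) / 4 + (\<Sum>u\<in>V. \<Sum>v\<in>V. wt u v * x u * x v) / 4"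
    by (simp add: sum.distrib deg_eq sum_distrib_left sum_distrib_right sum_divide_distrib)
  also have "(\<Sum>u\<in>V. \<Sum>v\<in>V. wt u v * x v) = (\<Sum>u\<in>V. deg u * x u)"
    by (subst sum.swap) (simp add: deg_eq sum_distrib_right wt_sym)
  finally show ?thesis
    by (simp add: sum_deg)
qed

section \<open>Restoring balance by moving vertices of low degree\<close>

lemma card_high_degree:
  assumes "0 < t"
  shows "t * real (card {v \<in> V. t < deg v}) \<le> 2 * real (card E)"
proof -
  have "t * real (card {v \<in> V. t < deg v}) = (\<Sum>v | v \<in> V \<and> t < deg v. t)"
    by simp
  also have "\<dots> \<le> (\<Sum>v | v \<in> V \<and> t < deg v. deg v)"
    by (intro sum_mono) auto
  also have "\<dots> \<le> (\<Sum>v\<in>V. deg v)"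
    using finite_vertices by (intro sum_mono2) (auto simp: deg_nonneg)
  finally show ?thesis
    by (simp add: sum_deg)
qed

text \<open>Half of the surplus is moved out of the larger side, using only vertices of degree at
  most \<open>t\<close>. The receiving side gains at most \<open>r * t\<close> edges, and the other
  side can only lose edges.\<close>

lemma rebalance_ordered:
  assumes part: "V1 \<union> V2 = V" "V1 \<inter> V2 = {}" and le: "card V2 \<le> card V1"
    and diff: "real (card V1) - real (card V2) \<le> \<kappa> * real (card V)"
    and \<kappa>: "\<kappa> \<le> 1/2" and n: "0 < card V" "0 < card E"
  shows "\<exists>W1 W2. bisection V W1 W2 \<and> edges_within E W1 \<le> edges_within E V1 \<and>
    real (edges_within E W2) \<le> real (edges_within E V2) + 4 * \<kappa> * real (card E)"
proof -
  \<comment> \<open>Rounding down leaves a difference of 0 or 1.\<close>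
  define r where "r = (card V1 - card V2) div 2"
  \<comment> \<open>Four times the average degree: by Markov's inequality at most a quarter of the
    vertices exceed it. The larger side holds at least half of all vertices, so \<open>H\<close>
    holds at least a quarter, which is enough for \<open>r\<close>.\<close>
  define t where "t = 8 * real (card E) / real (card V)"
  define H where "H = {v \<in> V1. deg v \<le> t}"
  have fin: "finite V1" "finite V2"
    using part finite_vertices by auto
  have card: "card V1 + card V2 = card V"
    using part fin by (metis card_Un_disjoint)
  have t: "0 < t"
    using n by (simp add: t_def)
  have r: "2 * real r \<le> \<kappa> * real (card V)"
    using diff le unfolding r_def by linarith
  have "card {v \<in> V. t < deg v} * 4 \<le> card V"
    using card_high_degree[OF t] n by (simp add: t_def field_simps)
  moreover have "card V1 \<le> card H + card {v \<in> V. t < deg v}"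
    using part fin finite_vertices
    by (intro order_trans[OF card_mono card_Un_le]) (auto simp: H_def)
  ultimately have "card V \<le> 4 * card H"
    using card le by linarith
  moreover have "\<kappa> * real (card V) \<le> real (card V) / 2"
    using \<kappa> mult_right_mono[of \<kappa> "1/2" "real (card V)"] by simp
  ultimately have "r \<le> card H"
    using r by linarith
  then obtain X where X: "X \<subseteq> H" "card X = r" "finite X"
    by (rule obtain_subset_with_card_n)
  have XV: "X \<subseteq> V1"
    using X by (auto simp: H_def)
  have sub: "edges_within E (V1 - X) \<le> edges_within E V1"
    unfolding edges_within_def using finite_edges by (intro card_mono) auto
  have "edges_within E (V2 \<union> X)
      \<le> card ({e \<in> E. e \<subseteq> V2} \<union> (\<Union>v\<in>X. {e \<in> E. v \<in> e}))"
    unfolding edges_within_def using finite_edges X by (intro card_mono) auto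
  also have "\<dots> \<le> edges_within E V2 + (\<Sum>v\<in>X. vertex_degree E v)"
    unfolding edges_within_def vertex_degree_def
    by (rule order_trans[OF card_Un_le add_left_mono[OF card_UN_le[OF X(3)]]])
  finally have "real (edges_within E (V2 \<union> X)) \<le> real (edges_within E V2) + (\<Sum>v\<in>X. deg v)"
    unfolding deg_def by (simp flip: of_nat_sum of_nat_add)
  also have "(\<Sum>v\<in>X. deg v) \<le> (\<Sum>v\<in>X. t)"
    using X by (intro sum_mono) (auto simp: H_def)
  also have "(\<Sum>v\<in>X. t) = real r * t"
    using X by simp
  also have "\<dots> \<le> \<kappa> * real (card V) / 2 * t"
    using r t by (intro mult_right_mono) auto
  also have "\<dots> = 4 * \<kappa> * real (card E)"
    using n by (simp add: t_def)
  finally have e2: "real (edges_within E (V2 \<union> X)) \<le> real (edges_within E V2) + 4 * \<kappa> * real (card E)"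
    by simp
  have "card (V1 - X) = card V1 - r"
    using X XV by (simp add: card_Diff_subset)
  moreover have "card (V2 \<union> X) = card V2 + r"
    using X XV fin part by (subst card_Un_disjoint) auto
  moreover have "r \<le> card V1"
    by (simp add: r_def)
  ultimately have "bisection V (V1 - X) (V2 \<union> X)"
    using part XV le unfolding bisection_def r_def by (auto simp: of_nat_diff)
  then show ?thesis
    using sub e2 by blast
qed

lemma bisection_commute: "bisection V V1 V2 \<Longrightarrow> bisection V V2 V1"
  by (auto simp: bisection_def)

lemma rebalance:
  assumes part: "V1 \<union> V2 = V" "V1 \<inter> V2 = {}"
    and diff: "\<bar>real (card V1) - real (card V2)\<bar> \<le> \<kappa> * real (card V)"
    and \<kappa>: "0 \<le> \<kappa>" "\<kappa> \<le> 1/2" and n: "0 < card V" "0 < card E"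
  shows "\<exists>W1 W2. bisection V W1 W2 \<and>
    real (edges_within E W1) \<le> real (edges_within E V1) + 4 * \<kappa> * real (card E) \<and>
    real (edges_within E W2) \<le> real (edges_within E V2) + 4 * \<kappa> * real (card E)"
proof -
  have nonneg: "0 \<le> 4 * \<kappa> * real (card E)"
    using \<kappa> by simp
  show ?thesis
  proof (cases "card V2 \<le> card V1")
    case True
    moreover have "real (card V1) - real (card V2) \<le> \<kappa> * real (card V)"
      using diff by linarith
    ultimately obtain W1 W2 where "bisection V W1 W2" "edges_within E W1 \<le> edges_within E V1"
      "real (edges_within E W2) \<le> real (edges_within E V2) + 4 * \<kappa> * real (card E)"
      using rebalance_ordered[OF part] \<kappa>(2) n by blast
    then show ?thesis
      using nonneg by (intro exI[of _ W1] exI[of _ W2]) auto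
  next
    case False
    from rebalance_ordered[of V2 V1, OF _ _ _ _ \<kappa>(2) n] part diff False
    obtain W1 W2 where "bisection V W1 W2" "edges_within E W1 \<le> edges_within E V2"
      "real (edges_within E W2) \<le> real (edges_within E V1) + 4 * \<kappa> * real (card E)"
      by (auto simp: Un_commute Int_commute)
    then show ?thesis
      using nonneg bisection_commute by (intro exI[of _ W2] exI[of _ W1]) auto
  qed
qed

end

section \<open>Cluster signs with small degree discrepancy and small imbalance\<close>

lemma sum_sum_mult: "(\<Sum>u\<in>V. \<Sum>v\<in>V. f u * g v) = sum f V * (sum g V :: real)"
  by (simp add: sum_product)

context simple_graph
begin

text \<open>One application of \<open>cluster_signs\<close> controls three quantities at once: the
  squares of the degree discrepancy \<open>S\<close> and of the imbalance \<open>N\<close> on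
  \<open>B\<close> are added to the adjacency form as penalties, and small clusters keep the
  diagonal part of the penalties small.\<close>

lemma balanced_signs:
  fixes c :: "'a \<Rightarrow> 'k" and h :: "'a \<Rightarrow> real"
  assumes B: "B \<subseteq> V" and h: "\<And>v. h v = 1 \<or> h v = - 1"
    and \<rho>: "0 < \<rho>" "\<rho> \<le> 1" and n: "0 < card V" "0 < card E"
    and const: "\<And>u v. u \<in> V - B \<Longrightarrow> v \<in> V - B \<Longrightarrow> c u = c v"
    and deg_small: "(\<Sum>u\<in>B. \<Sum>v | v \<in> B \<and> c v = c u. deg u * deg v) \<le> \<rho> ^ 3 * real (card E) ^ 2"
    and card_small: "(\<Sum>u\<in>B. real (card {v \<in> B. c v = c u})) \<le> \<rho> ^ 3 * real (card V) ^ 2"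
  shows "\<exists>x. (\<forall>v. x v = 1 \<or> x v = - 1) \<and>
    (\<Sum>u\<in>V. \<Sum>v\<in>V. wt u v * x u * x v)
      \<le> (\<Sum>u\<in>V. \<Sum>v | v \<in> V \<and> c v = c u. wt u v * h u * h v) + 2 * \<rho> * real (card E) \<and>
    \<bar>\<Sum>v\<in>B. deg v * x v\<bar> \<le> 3 * \<rho> * real (card E) \<and>
    \<bar>\<Sum>v\<in>B. x v\<bar> \<le> 3 * \<rho> * real (card V) \<and>
    \<bar>\<Sum>v\<in>V - B. deg v * x v\<bar> = \<bar>\<Sum>v\<in>V - B. deg v * h v\<bar>"
proof -
  define m n' where "m = real (card E)" and "n' = real (card V)"
  have pos: "0 < m" "0 < n'"
    using n by (auto simp: m_def n'_def)
  \<comment> \<open>With these weights each penalty has diagonal at most \<open>\<rho> * m\<close>,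
    while a total penalty of at most \<open>6 * m\<close> still forces \<open>S\<close> and
    \<open>N\<close> to be of order \<open>\<rho> * m\<close> and
    \<open>\<rho> * n'\<close>.\<close>
  define t t' where "t = 1 / (\<rho>\<^sup>2 * m)" and "t' = m / (\<rho>\<^sup>2 * n'\<^sup>2)"
  have t: "0 < t" "0 < t'"
    using pos \<rho> by (auto simp: t_def t'_def)
  define d i where "d v = (if v \<in> B then deg v else 0)" and "i v = (if v \<in> B then 1 else 0 :: real)" for v
  define q where "q u v = wt u v + t * (d u * d v) + t' * (i u * i v)" for u v
  obtain s :: "'k \<Rightarrow> real" where s: "\<And>k. s k = 1 \<or> s k = - 1"
    and le: "(\<Sum>u\<in>V. \<Sum>v\<in>V. q u v * (h u * s (c u)) * (h v * s (c v)))
      \<le> (\<Sum>u\<in>V. \<Sum>v | v \<in> V \<and> c v = c u. q u v * h u * h v)"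
    using cluster_signs[OF finite_vertices, of q h c] by auto
  define x where "x v = h v * s (c v)" for v
  define Q where "Q = (\<Sum>u\<in>V. \<Sum>v\<in>V. wt u v * x u * x v)"
  define Qd where "Qd = (\<Sum>u\<in>V. \<Sum>v | v \<in> V \<and> c v = c u. wt u v * h u * h v)"
  define S N where "S = (\<Sum>v\<in>B. deg v * x v)" and "N = (\<Sum>v\<in>B. x v)"
  have x: "x v = 1 \<or> x v = - 1" for v
    using h[of v] s[of "c v"] by (auto simp: x_def)
  have hh: "\<bar>h u * h v\<bar> \<le> 1" for u v
    using h[of u] h[of v] by auto
  have restrict: "(\<Sum>v\<in>V. if v \<in> B then f v else 0) = sum f B" for f :: "'a \<Rightarrow> real"
    using B finite_vertices by (simp add: sum.If_cases Int_absorb1)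
  have "(\<Sum>u\<in>V. \<Sum>v\<in>V. q u v * x u * x v)
      = Q + t * (\<Sum>u\<in>V. \<Sum>v\<in>V. (d u * x u) * (d v * x v))
        + t' * (\<Sum>u\<in>V. \<Sum>v\<in>V. (i u * x u) * (i v * x v))"
    unfolding Q_def q_def
    by (simp add: sum.distrib sum_distrib_left sum_distrib_right algebra_simps)
  also have "\<dots> = Q + t * S\<^sup>2 + t' * N\<^sup>2"
  proof -
    have "(\<Sum>u\<in>V. d u * x u) = S" "(\<Sum>u\<in>V. i u * x u) = N"
      unfolding S_def N_def restrict[symmetric] by (auto simp: d_def i_def intro!: sum.cong)
    then show ?thesis
      by (simp add: sum_sum_mult power2_eq_square)
  qed
  finally have lhs: "Q + t * S\<^sup>2 + t' * N\<^sup>2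
      \<le> (\<Sum>u\<in>V. \<Sum>v | v \<in> V \<and> c v = c u. q u v * h u * h v)"
    using le by (simp add: x_def)
  have "(\<Sum>u\<in>V. \<Sum>v | v \<in> V \<and> c v = c u. q u v * h u * h v)
      \<le> (\<Sum>u\<in>V. \<Sum>v | v \<in> V \<and> c v = c u. wt u v * h u * h v + t * (d u * d v) + t' * (i u * i v))"
  proof (intro sum_mono)
    fix u v
    have "(t * (d u * d v) + t' * (i u * i v)) * (h u * h v) \<le> (t * (d u * d v) + t' * (i u * i v)) * 1"
      using t hh[of u v] by (intro mult_left_mono) (auto simp: d_def i_def deg_nonneg)
    then show "q u v * h u * h v \<le> wt u v * h u * h v + t * (d u * d v) + t' * (i u * i v)"
      by (simp add: q_def algebra_simps)
  qed
  also have "\<dots> = Qd + t * (\<Sum>u\<in>V. \<Sum>v | v \<in> V \<and> c v = c u. d u * d v)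
      + t' * (\<Sum>u\<in>V. \<Sum>v | v \<in> V \<and> c v = c u. i u * i v)"
    by (simp add: Qd_def sum.distrib sum_distrib_left)
  also have "(\<Sum>u\<in>V. \<Sum>v | v \<in> V \<and> c v = c u. d u * d v)
      = (\<Sum>u\<in>B. \<Sum>v | v \<in> B \<and> c v = c u. deg u * deg v)"
    unfolding restrict[symmetric]
  proof (intro sum.cong refl)
    fix u
    have "(\<Sum>v | v \<in> V \<and> c v = c u. d u * d v) = (\<Sum>v | v \<in> B \<and> c v = c u. d u * d v)"
      using B finite_vertices by (intro sum.mono_neutral_right) (auto simp: d_def)
    then show "(\<Sum>v | v \<in> V \<and> c v = c u. d u * d v)
        = (if u \<in> B then \<Sum>v | v \<in> B \<and> c v = c u. deg u * deg v else 0)"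
      by (auto simp: d_def)
  qed
  also have "(\<Sum>u\<in>V. \<Sum>v | v \<in> V \<and> c v = c u. i u * i v)
      = (\<Sum>u\<in>B. real (card {v \<in> B. c v = c u}))"
    unfolding restrict[symmetric]
  proof (intro sum.cong refl)
    fix u
    have "(\<Sum>v | v \<in> V \<and> c v = c u. i u * i v) = (\<Sum>v | v \<in> B \<and> c v = c u. i u * i v)"
      using B finite_vertices by (intro sum.mono_neutral_right) (auto simp: i_def)
    then show "(\<Sum>v | v \<in> V \<and> c v = c u. i u * i v)
        = (if u \<in> B then real (card {v \<in> B. c v = c u}) else 0)"
      by (auto simp: i_def)
  qed
  also have "Qd + t * (\<Sum>u\<in>B. \<Sum>v | v \<in> B \<and> c v = c u. deg u * deg v)
        + t' * (\<Sum>u\<in>B. real (card {v \<in> B. c v = c u}))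
      \<le> Qd + t * (\<rho> ^ 3 * m\<^sup>2) + t' * (\<rho> ^ 3 * n'\<^sup>2)"
    using deg_small card_small t unfolding m_def n'_def
    by (intro add_mono mult_left_mono) auto
  also have "\<dots> = Qd + 2 * \<rho> * m"
    using pos \<rho> by (simp add: t_def t'_def power2_eq_square power3_eq_cube)
  finally have main: "Q + t * S\<^sup>2 + t' * N\<^sup>2 \<le> Qd + 2 * \<rho> * m"
    using lhs by linarith
  have total: "(\<Sum>u\<in>V. \<Sum>v\<in>V. wt u v) = 2 * m"
    by (simp add: m_def deg_eq[symmetric] sum_deg)
  \<comment> \<open>The trivial bounds on \<open>Q\<close> and \<open>Qd\<close> turn
    \<open>main\<close> into an upper bound for the two squares.\<close>
  have "- (2 * m) \<le> Q"
    unfolding Q_def total[symmetric] sum_negf[symmetric]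
  proof (intro sum_mono)
    fix u v
    show "- wt u v \<le> wt u v * x u * x v"
      using x[of u] x[of v] wt_nonneg[of u v] by auto
  qed
  moreover have "Qd \<le> 2 * m"
  proof -
    have "Qd \<le> (\<Sum>u\<in>V. \<Sum>v | v \<in> V \<and> c v = c u. wt u v)"
      unfolding Qd_def
    proof (intro sum_mono)
      fix u v
      show "wt u v * h u * h v \<le> wt u v"
        using h[of u] h[of v] wt_nonneg[of u v] by auto
    qed
    also have "\<dots> \<le> (\<Sum>u\<in>V. \<Sum>v\<in>V. wt u v)"
      using finite_vertices by (intro sum_mono sum_mono2) (auto simp: wt_nonneg)
    finally show ?thesis
      using total by simp
  qed
  moreover have "2 * \<rho> * m \<le> 2 * m"
    using \<rho> pos by simp
  ultimately have six: "t * S\<^sup>2 + t' * N\<^sup>2 \<le> 6 * m"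
    using main by linarith
  have "0 \<le> t * S\<^sup>2" "0 \<le> t' * N\<^sup>2"
    using t by auto
  with six main have "t * S\<^sup>2 \<le> 6 * m" "t' * N\<^sup>2 \<le> 6 * m" and Q: "Q \<le> Qd + 2 * \<rho> * m"
    by linarith+
  then have "S\<^sup>2 \<le> 6 * (\<rho> * m)\<^sup>2" "N\<^sup>2 \<le> 6 * (\<rho> * n')\<^sup>2"
    using pos \<rho> by (auto simp: t_def t'_def field_simps power2_eq_square)
  moreover have "6 * y\<^sup>2 \<le> (3 * y)\<^sup>2" for y :: real
    by (simp add: power_mult_distrib)
  ultimately have "\<bar>S\<bar>\<^sup>2 \<le> (3 * (\<rho> * m))\<^sup>2" "\<bar>N\<bar>\<^sup>2 \<le> (3 * (\<rho> * n'))\<^sup>2"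
    unfolding power2_abs by (meson order_trans)+
  then have SN: "\<bar>S\<bar> \<le> 3 * \<rho> * m" "\<bar>N\<bar> \<le> 3 * \<rho> * n'"
    using pos \<rho> power2_le_imp_le[of "\<bar>S\<bar>" "3 * (\<rho> * m)"]
      power2_le_imp_le[of "\<bar>N\<bar>" "3 * (\<rho> * n')"] by (auto simp: mult.assoc)
  \<comment> \<open>All of \<open>V - B\<close> lies in one cluster, so there \<open>x\<close>
    equals \<open>h\<close> up to a common sign.\<close>
  have "\<bar>\<Sum>v\<in>V - B. deg v * x v\<bar> = \<bar>\<Sum>v\<in>V - B. deg v * h v\<bar>"
  proof (cases "V - B = {}")
    case False
    then obtain a where a: "a \<in> V - B"
      by blast
    have "(\<Sum>v\<in>V - B. deg v * x v) = (\<Sum>v\<in>V - B. deg v * h v) * s (c a)"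
      unfolding sum_distrib_right x_def
      using const[OF _ a] by (intro sum.cong) (auto simp: mult.assoc)
    then show ?thesis
      using s[of "c a"] by (auto simp: abs_mult)
  qed (simp only: sum.empty)
  then show ?thesis
    using x Q SN unfolding Q_def Qd_def S_def N_def m_def n'_def by (intro exI[of _ x]) blast
qed

end

subsection \<open>Partition into stars\<close>

text \<open>The orbits \<open>{x, p x}\<close> are pairs; they are removed one at a time.\<close>

lemma even_card_involution:
  assumes "finite X" and "\<And>x. x \<in> X \<Longrightarrow> p x \<in> X \<and> p x \<noteq> x \<and> p (p x) = x"
  shows "even (card X)"
  using assms
proof (induction "card X" arbitrary: X rule: less_induct)
  case less
  show ?case
  proof (cases "X = {}")
    case False
    then obtain x where x: "x \<in> X"
      by blast
    let ?Y = "X - {x, p x}"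
    have sub: "{x, p x} \<subseteq> X" and two: "card {x, p x} = 2"
      using less.prems(2)[OF x] x by auto
    then have eq: "card X = card ?Y + 2"
      using less.prems(1) card_mono[OF less.prems(1) sub] by (simp add: card_Diff_subset)
    have "p y \<in> ?Y \<and> p y \<noteq> y \<and> p (p y) = y" if "y \<in> ?Y" for y
      using that less.prems(2)[of y] less.prems(2)[OF x] by auto
    then have "even (card ?Y)"
      using less.hyps[of ?Y] less.prems(1) eq by auto
    then show ?thesis
      using eq by simp
  qed auto
qed

text \<open>
  A matching is encoded by an involution whose non-fixed points are the matched vertices. It is
  chosen with as many matched vertices as possible and, subject to that, as many unmatched
  vertices \<open>v\<close> as possible that are adjacent to exactly one endpoint of some matching edge. Such a
  \<open>v\<close> can be added as a leaf to that edge. The remaining unmatched vertices form \<open>Z\<close>; exchanging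
  \<open>z \<in> Z\<close> with a neighbour shows that the neighbour satisfies the same condition with respect to
  another optimal matching, whence the parity of its degree.
\<close>

lemma star_partition:
  fixes adj :: "'a \<Rightarrow> 'a \<Rightarrow> bool"
  assumes fin: "finite B" and "symp adj" "irreflp adj"
  shows "\<exists>c Z. Z \<subseteq> B \<and> (\<forall>v\<in>B. c v \<in> B \<and> c (c v) = c v \<and> (c v \<noteq> v \<longrightarrow> adj v (c v))) \<and>
    (\<forall>u\<in>B. \<forall>v\<in>B. c u = c v \<and> c u \<noteq> u \<and> c v \<noteq> v \<longrightarrow> \<not> adj u v) \<and>
    card B \<le> card Z + 2 * card {v \<in> B. c v \<noteq> v} \<and>
    (\<forall>z\<in>Z. \<forall>z'\<in>Z. z \<noteq> z' \<longrightarrow>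
      insert z {v \<in> B. adj z v} \<inter> insert z' {v \<in> B. adj z' v} = {}) \<and>
    (\<forall>z\<in>Z. \<forall>w \<in> insert z {v \<in> B. adj z v}. even (card {v \<in> B. adj w v}))"
proof -
  have sym: "adj u v \<Longrightarrow> adj v u" and irrefl: "\<not> adj v v" for u v
    using assms(2,3) by (auto dest: sympD irreflpD)
  define matching where "matching p \<longleftrightarrow>
    (\<forall>v\<in>B. p v \<in> B \<and> p (p v) = v \<and> (p v \<noteq> v \<longrightarrow> adj v (p v)))" for p
  define matched where "matched p = {v \<in> B. p v \<noteq> v}" for p :: "'a \<Rightarrow> 'a"
  define good where "good p = {v \<in> B. p v = v \<and> (\<exists>x\<in>B. adj v x \<and> \<not> adj v (p x))}" for p
  \<comment> \<open>The factor exceeds every possible value of \<open>card (good p)\<close>, so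
    maximising \<open>f\<close> is a lexicographic maximisation with the matched vertices
    first.\<close>
  define f where "f p = (card B + 1) * card (matched p) + card (good p)" for p
  have fins: "finite (matched p)" "finite (good p)" for p
    using fin by (auto simp: matched_def good_def)
  have cards: "card (matched p) \<le> card B" "card (good p) \<le> card B" for p
    using fin by (auto simp: matched_def good_def intro!: card_mono)
  have "matching id"
    by (auto simp: matching_def)
  moreover have "f p < (card B + 1) * card B + card B + 1" for p
    using mult_left_mono[OF cards(1), of "card B + 1" p] cards(2)[of p] unfolding f_def by linarith
  ultimately have "\<exists>p. matching p \<and> (\<forall>p'. matching p' \<longrightarrow> f p' \<le> f p)"
    by (intro Lattices_Big.ex_has_greatest_nat) auto
  then obtain p where p: "matching p" and max: "\<And>p'. matching p' \<Longrightarrow> f p' \<le> f p"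
    by blast
  have pB: "p v \<in> B" "p (p v) = v" and padj: "p v \<noteq> v \<Longrightarrow> adj v (p v)" if "v \<in> B" for v
    using p that by (auto simp: matching_def)
  have max_matched: "card (matched p') \<le> card (matched p)" if "matching p'" for p'
  proof (rule ccontr)
    assume "\<not> ?thesis"
    then have "(card B + 1) * (card (matched p) + 1) \<le> (card B + 1) * card (matched p')"
      by (intro mult_left_mono) auto
    with max[OF that] cards(2)[of p] show False
      unfolding f_def by (simp add: algebra_simps)
  qed
  have unmatched: "\<not> adj u v" if uv: "u \<in> B" "v \<in> B" "p u = u" "p v = v" for u v
  proof
    assume a: "adj u v"
    then have "u \<noteq> v"
      using irrefl by auto
    \<comment> \<open>Adds the edge \<open>{u, v}\<close> to the matching.\<close>
    define p' where "p' = p(u := v, v := u)"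
    have "p w \<noteq> u" "p w \<noteq> v" if "w \<in> B" "w \<noteq> u" "w \<noteq> v" for w
      using pB(2)[of w] that uv by auto
    then have "matching p'"
      using uv a sym[OF a] pB padj \<open>u \<noteq> v\<close> by (auto simp: matching_def p'_def)
    moreover have "matched p \<subset> matched p'"
      using uv \<open>u \<noteq> v\<close> by (auto simp: matched_def p'_def)
    then have "card (matched p) < card (matched p')"
      using fins by (intro psubset_card_mono)
    ultimately show False
      using max_matched by fastforce
  qed
  have augment: "\<not> adj v (p x)"
    if uv: "u \<in> B" "v \<in> B" "p u = u" "p v = v" "u \<noteq> v" and x: "x \<in> B" "adj u x" for u v x
  proof
    assume a: "adj v (p x)"
    have xne: "p x \<noteq> x"
      using unmatched[of u x] uv x by auto
    have ne: "u \<noteq> x" "v \<noteq> x" "u \<noteq> p x" "v \<noteq> p x"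
      using uv x xne pB[OF x(1)] by auto
    \<comment> \<open>Switches along the augmenting path \<open>u\<close>, \<open>x\<close>,
      \<open>p x\<close>, \<open>v\<close>.\<close>
    define p' where "p' = p(u := x, x := u, v := p x, p x := v)"
    have "p w \<notin> {u, v, x, p x}" if "w \<in> B" "w \<notin> {u, v, x, p x}" for w
      using pB(2)[of w] pB(2)[of x] that uv x by auto
    then have "matching p'"
      using uv x a sym[OF a] sym[OF x(2)] pB padj ne xne by (auto simp: matching_def p'_def)
    moreover have "matched p \<subset> matched p'"
      using uv ne xne by (auto simp: matched_def p'_def)
    then have "card (matched p) < card (matched p')"
      using fins by (intro psubset_card_mono)
    ultimately show False
      using max_matched by fastforce
  qed
  define Z where "Z = {v \<in> B. p v = v} - good p"
  have Zadj: "adj z (p x)" if "z \<in> Z" "x \<in> B" "adj z x" for z x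
    using that by (auto simp: Z_def good_def)
  have Zun: "z \<in> B" "p z = z" if "z \<in> Z" for z
    using that by (auto simp: Z_def)
  \<comment> \<open>A common neighbour \<open>v\<close> of \<open>z\<close> and \<open>z'\<close>
    would give the augmenting path \<open>z\<close>, \<open>v\<close>, \<open>p v\<close>,
    \<open>z'\<close>, since \<open>z'\<close> sees both ends of the matching edge at
    \<open>v\<close>.\<close>
  have disj: "insert z {v \<in> B. adj z v} \<inter> insert z' {v \<in> B. adj z' v} = {}"
    if z: "z \<in> Z" "z' \<in> Z" "z \<noteq> z'" for z z'
  proof -
    have "\<not> adj z z'" "\<not> adj z' z"
      using unmatched Zun z by auto
    moreover have "\<not> (adj z v \<and> adj z' v)" if "v \<in> B" for v
      using augment[of z z' v] Zadj[of z' v] Zun z that by auto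
    ultimately show ?thesis
      using z by auto
  qed
  \<comment> \<open>The matching pairs up the neighbours of \<open>z\<close>: none is unmatched, and
    \<open>Zadj\<close> keeps partners inside the neighbourhood.\<close>
  have even_z: "even (card {v \<in> B. adj z v})" if "z \<in> Z" for z
  proof (rule even_card_involution[where p = p])
    fix x assume "x \<in> {v \<in> B. adj z v}"
    then show "p x \<in> {v \<in> B. adj z v} \<and> p x \<noteq> x \<and> p (p x) = x"
      using Zadj[OF that] pB unmatched[of z x] Zun[OF that] by auto
  qed (use fin in auto)
  have even_w: "even (card {v \<in> B. adj w v})" if z: "z \<in> Z" and w: "w \<in> B" "adj z w" for z w
  proof -
    define w' where "w' = p w"
    have ww: "w' \<noteq> w" "w' \<in> B" "p w' = w" "adj z w'"
      using unmatched[of z w] Zun[OF z] w pB[of w] Zadj[OF z w] by (auto simp: w'_def)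
    have zz: "z \<in> B" "p z = z" "z \<noteq> w" "z \<noteq> w'"
      using Zun[OF z] w ww irrefl by auto
    \<comment> \<open>The edge \<open>{w, w'}\<close> is exchanged for \<open>{z, w'}\<close>, so
      \<open>w\<close> takes over the role of the unmatched vertex \<open>z\<close>.\<close>
    define p' where "p' = p(z := w', w' := z, w := w)"
    have "p v \<notin> {z, w, w'}" if "v \<in> B" "v \<notin> {z, w, w'}" for v
      using pB(2)[of v] that zz ww w'_def by auto
    then have p': "matching p'"
      using pB padj ww zz w sym[OF ww(4)] by (auto simp: matching_def p'_def)
    have "matched p' = insert z (matched p - {w})"
      using zz ww w w'_def by (auto simp: matched_def p'_def)
    moreover have "w \<in> matched p" "z \<notin> matched p"
      using zz ww w w'_def by (auto simp: matched_def)
    ultimately have "card (matched p') = Suc (card (matched p - {w}))"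
      by (simp only: card_insert_disjoint fins finite_Diff Diff_iff simp_thms)
    also have "\<dots> = card (matched p)"
      using fins(1) \<open>w \<in> matched p\<close> by (rule card_Suc_Diff1)
    finally have "card (matched p') = card (matched p)" .
    then have "card (good p') \<le> card (good p)"
      using max[OF p'] by (simp add: f_def)
    \<comment> \<open>The matching edge witnessing that \<open>u\<close> is good is not
      \<open>{w, w'}\<close>: as \<open>z\<close> sees both of its ends, it would yield an
      augmenting path from \<open>u\<close> to \<open>z\<close>. Hence the witness survives the
      exchange.\<close>
    moreover have sub: "good p \<subseteq> good p'"
    proof
      fix u assume u: "u \<in> good p"
      then obtain x where x: "u \<in> B" "p u = u" "x \<in> B" "adj u x" "\<not> adj u (p x)"
        by (auto simp: good_def)
      have "u \<noteq> z"
        using u z by (auto simp: Z_def)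
      have "x \<noteq> z"
        using unmatched[of u z] x zz by auto
      moreover have "x \<noteq> w"
        using augment[of u z w] x zz w ww \<open>u \<noteq> z\<close> w'_def by auto
      moreover have "x \<noteq> w'"
        using augment[of u z w'] x zz w ww \<open>u \<noteq> z\<close> by auto
      ultimately have "p' x = p x"
        by (simp add: p'_def)
      moreover have "p' u = u"
        using x \<open>u \<noteq> z\<close> ww w'_def by (auto simp: p'_def)
      ultimately show "u \<in> good p'"
        using x by (auto simp: good_def)
    qed
    ultimately have "good p' = good p"
      using fins by (metis card_seteq)
    \<comment> \<open>By optimality no new good vertex appears. Since \<open>w\<close> is matched by
      \<open>p\<close> it is not good for \<open>p\<close>, hence not for \<open>p'\<close>, and its
      neighbourhood is closed under \<open>p'\<close>.\<close>
    moreover have "w \<notin> good p"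
      using ww w'_def by (auto simp: good_def)
    ultimately have "w \<notin> good p'"
      by simp
    then have closed: "adj w (p' x)" if "x \<in> B" "adj w x" for x
      using that w by (auto simp: good_def p'_def)
    show ?thesis
    proof (rule even_card_involution[where p = p'])
      fix x assume "x \<in> {v \<in> B. adj w v}"
      then have x: "x \<in> B" "adj w x"
        by auto
      \<comment> \<open>A neighbour \<open>x\<close> of \<open>w\<close> fixed by \<open>p'\<close>
        is unmatched in \<open>p\<close> too, and \<open>x\<close>, \<open>w\<close>,
        \<open>w'\<close>, \<open>z\<close> would be augmenting.\<close>
      have "p' x \<noteq> x"
      proof
        assume fixed: "p' x = x"
        have "x \<noteq> w"
          using x irrefl by auto
        moreover have "x \<noteq> z" "x \<noteq> w'"
          using fixed zz ww by (auto simp: p'_def)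
        ultimately have "p x = x"
          using fixed by (simp add: p'_def)
        then show False
          using augment[of x z w] x zz w ww(4) sym[OF x(2)] \<open>x \<noteq> z\<close> w'_def by simp
      qed
      then show "p' x \<in> {v \<in> B. adj w v} \<and> p' x \<noteq> x \<and> p' (p' x) = x"
        using x closed p' by (auto simp: matching_def)
    qed (use fin in auto)
  qed
  define g where "g v = (SOME x. x \<in> B \<and> adj v x \<and> \<not> adj v (p x))" for v
  have g: "g v \<in> B \<and> adj v (g v) \<and> \<not> adj v (p (g v))" if "v \<in> good p" for v
    unfolding g_def by (rule someI_ex) (use that in \<open>auto simp: good_def\<close>)
  define R where "R = g ` good p"
  \<comment> \<open>Good vertices never attach to both ends of one matching edge: two different ones
    would form an augmenting path, and a single one sees only one end.\<close>
  have R: "p x \<notin> R" if xR: "x \<in> R" for x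
  proof
    assume "p x \<in> R"
    then obtain u v where "u \<in> good p" "x = g u" "v \<in> good p" "p x = g v"
      using xR by (auto simp: R_def)
    then show False
      using g[of u] g[of v] augment[of u v x] by (cases "u = v") (auto simp: good_def)
  qed
  \<comment> \<open>The centre of the star grown from \<open>{x, p x}\<close> is the end to which
    good vertices attach, if there is one. The default choice depends only on the set
    \<open>{x, p x}\<close>, so both ends agree on it.\<close>
  define rep where "rep x = (if x \<in> R then x else if p x \<in> R then p x else SOME y. y \<in> {x, p x})" for x
  have rep_in: "rep x \<in> {x, p x}" for x
    using someI[of "\<lambda>y. y \<in> {x, p x}" x] by (auto simp: rep_def)
  have rep_p: "rep (p x) = rep x" if "x \<in> B" for x
    using R[of x] R[of "p x"] pB[OF that] by (auto simp: rep_def insert_commute)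
  define c where "c v = (if p v \<noteq> v then rep v else if v \<in> good p then g v else v)" for v
  have g_matched: "p (g v) \<noteq> g v" if "v \<in> good p" for v
    using g[OF that] by auto
  have c_g: "c (g v) = g v" if "v \<in> good p" for v
    using that g_matched[OF that] by (auto simp: c_def rep_def R_def)
  have rep_matched: "p (rep v) \<noteq> rep v" if "v \<in> B" "p v \<noteq> v" for v
    using rep_in[of v] pB[OF that(1)] that(2) by auto
  have c_rep: "c (rep v) = rep v" if "v \<in> B" "p v \<noteq> v" for v
    using rep_in[of v] rep_p[OF that(1)] rep_matched[OF that] by (auto simp: c_def)
  have c_star: "c v \<in> B \<and> c (c v) = c v \<and> (c v \<noteq> v \<longrightarrow> adj v (c v))" if v: "v \<in> B" for v
  proof (cases "p v = v")
    case True
    then show ?thesis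
      using v g[of v] c_g[of v] by (auto simp: c_def)
  next
    case False
    then have "c v = rep v"
      by (simp add: c_def)
    then show ?thesis
      using rep_in[of v] pB[OF v] padj[OF v False] c_rep[OF v False] v by auto
  qed
  have leaves: "\<not> adj u v"
    if uv: "u \<in> B" "v \<in> B" "c u = c v" "c u \<noteq> u" "c v \<noteq> v" for u v
  proof -
    have matched_leaf: "c y = p y" if "p y \<noteq> y" "c y \<noteq> y" for y
      using that rep_in[of y] by (auto simp: c_def)
    \<comment> \<open>The matched leaf is the partner of the centre \<open>g b\<close>, and
      \<open>g\<close> was chosen so that \<open>b\<close> does not see that partner.\<close>
    have mixed: "\<not> adj b a" if ab: "a \<in> B" "b \<in> B" "c a = c b" "c a \<noteq> a" "c b \<noteq> b" "p a \<noteq> a" "p b = b" for a b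
    proof -
      have "b \<in> good p" "g b = c b"
        using ab by (auto simp: c_def split: if_splits)
      moreover have "a = p (c a)"
        using ab matched_leaf[of a] pB[of a] by auto
      ultimately show ?thesis
        using g[of b] ab by auto
    qed
    show ?thesis
    proof (cases "p u = u"; cases "p v = v")
      assume "p u = u" "p v = v"
      then show ?thesis
        using unmatched uv by auto
    next
      assume "p u = u" "p v \<noteq> v"
      then show ?thesis
        using mixed[of v u] uv by auto
    next
      assume "p u \<noteq> u" "p v = v"
      then show ?thesis
        using mixed[of u v] uv sym by metis
    next
      assume "p u \<noteq> u" "p v \<noteq> v"
      then have "p u = p v"
        using matched_leaf uv by metis
      then have "u = v"
        using pB uv by metis
      then show ?thesis
        using irrefl by auto
    qed
  qed
  define Lv where "Lv = {v \<in> B. c v \<noteq> v}"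
  \<comment> \<open>Outside \<open>Z\<close> every vertex is a leaf or the centre of a leaf, and
    there are at most as many such centres as leaves.\<close>
  have "B \<subseteq> Z \<union> (Lv \<union> c ` Lv)"
  proof
    fix v assume v: "v \<in> B"
    show "v \<in> Z \<union> (Lv \<union> c ` Lv)"
    proof (cases "c v = v")
      case False
      then show ?thesis
        using v by (auto simp: Lv_def)
    next
      case True
      show ?thesis
      proof (cases "p v = v")
        assume un: "p v = v"
        have "v \<notin> good p"
          using g[of v] irrefl[of v] True un by (auto simp: c_def)
        then show ?thesis
          using v un by (auto simp: Z_def)
      next
        assume m: "p v \<noteq> v"
        then have "rep v = v"
          using True by (simp add: c_def)
        then have "c (p v) = v"
          using m pB[OF v] rep_p[OF v] by (auto simp: c_def)
        then show ?thesis
          using m pB[OF v] by (auto simp: Lv_def intro!: image_eqI[of v c "p v"])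
      qed
    qed
  qed
  then have "card B \<le> card (Z \<union> (Lv \<union> c ` Lv))"
    using fin by (intro card_mono) (auto simp: Z_def Lv_def)
  also have "\<dots> \<le> card Z + (card Lv + card (c ` Lv))"
    by (rule order_trans[OF card_Un_le add_left_mono[OF card_Un_le]])
  also have "card (c ` Lv) \<le> card Lv"
    using fin by (intro card_image_le) (auto simp: Lv_def)
  finally have "card B \<le> card Z + 2 * card Lv"
    by simp
  then show ?thesis
    using c_star leaves disj even_z even_w Zun unfolding Lv_def
    by (intro exI[of _ c] exI[of _ Z]) blast
qed

subsection \<open>Signs on the vertices of high degree\<close>

text \<open>Pair the numbers up arbitrarily; each pair contributes a difference of size at most \<open>N - \<theta>\<close>.\<close>

lemma signed_sum_even:
  fixes w :: "'a \<Rightarrow> real"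
  assumes "finite L" "card L = 2 * k" and "\<And>a. a \<in> L \<Longrightarrow> \<theta> \<le> w a \<and> w a \<le> N" and "\<theta> \<le> N"
  shows "\<exists>s. (\<forall>a. s a = 1 \<or> s a = - 1) \<and> \<bar>\<Sum>a\<in>L. s a * w a\<bar> \<le> N - \<theta>"
  using assms
proof (induction k arbitrary: L)
  case 0
  then show ?case
    by (intro exI[of _ "\<lambda>_. 1"]) auto
next
  case (Suc k)
  obtain a L1 where L1: "L = insert a L1" "a \<notin> L1" "card L1 = Suc (2 * k)"
    using Suc.prems(2) card_Suc_eq[of L "Suc (2 * k)"] by auto
  obtain b L2 where L2: "L1 = insert b L2" "b \<notin> L2" "card L2 = 2 * k"
    using L1(3) card_Suc_eq[of L1 "2 * k"] by auto
  have fin: "finite L2"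
    using Suc.prems(1) L1 L2 by auto
  obtain s where s: "\<forall>a. s a = 1 \<or> s a = - 1" "\<bar>\<Sum>a\<in>L2. s a * w a\<bar> \<le> N - \<theta>"
    using Suc.IH[of L2] fin Suc.prems(3,4) L1 L2 by auto
  define r where "r = (\<Sum>a\<in>L2. s a * w a)"
  have ab: "\<theta> \<le> w a" "w a \<le> N" "\<theta> \<le> w b" "w b \<le> N" "a \<noteq> b" "a \<notin> L2"
    using Suc.prems(3) L1 L2 by auto
  \<comment> \<open>When \<open>e * (w a - w b)\<close> opposes \<open>r\<close>, the absolute value
    of the sum is at most the larger of the two absolute values.\<close>
  obtain e :: real where e: "e = 1 \<or> e = - 1" "\<bar>r + e * (w a - w b)\<bar> \<le> N - \<theta>"
  proof (cases "0 \<le> r \<longleftrightarrow> w a \<le> w b")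
    case True
    then show ?thesis
      using that[of 1] s(2) ab unfolding r_def[symmetric] by fastforce
  next
    case False
    then show ?thesis
      using that[of "- 1"] s(2) ab unfolding r_def[symmetric] by fastforce
  qed
  define s' where "s' = s(a := e, b := - e)"
  have "(\<Sum>a\<in>L2. s' a * w a) = r"
    unfolding r_def using ab L2 by (intro sum.cong) (auto simp: s'_def)
  then have "(\<Sum>a\<in>L. s' a * w a) = r + e * (w a - w b)"
    using L1 L2 fin ab by (simp add: s'_def algebra_simps)
  then show ?case
    using s e by (intro exI[of _ s']) (auto simp: s'_def)
qed

text \<open>Always choosing the sign that moves the partial sum towards \<open>0\<close>.\<close>

lemma signed_sum_greedy:
  fixes w :: "'a \<Rightarrow> real"
  assumes "finite S" and "\<And>a. a \<in> S \<Longrightarrow> 0 \<le> w a \<and> w a < \<theta>"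
  shows "\<exists>s. (\<forall>a. s a = 1 \<or> s a = - 1) \<and>
    (\<bar>r + (\<Sum>a\<in>S. s a * w a)\<bar> < \<theta> \<or> \<bar>r + (\<Sum>a\<in>S. s a * w a)\<bar> \<le> \<bar>r\<bar> - sum w S)"
  using assms
proof (induction S)
  case empty
  show ?case
    by (intro exI[of _ "\<lambda>_. 1"]) auto
next
  case (insert a S)
  then obtain s where s: "\<forall>a. s a = 1 \<or> s a = - 1"
    and le: "\<bar>r + (\<Sum>a\<in>S. s a * w a)\<bar> < \<theta> \<or> \<bar>r + (\<Sum>a\<in>S. s a * w a)\<bar> \<le> \<bar>r\<bar> - sum w S"
    by auto
  define t where "t = r + (\<Sum>a\<in>S. s a * w a)"
  define e :: real where "e = (if 0 \<le> t then - 1 else 1)"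
  define s' where "s' = s(a := e)"
  have a: "0 \<le> w a" "w a < \<theta>"
    using insert.prems by auto
  have "(\<Sum>b\<in>S. s' b * w b) = (\<Sum>b\<in>S. s b * w b)"
    using insert.hyps by (intro sum.cong) (auto simp: s'_def)
  then have "r + (\<Sum>b\<in>insert a S. s' b * w b) = t + e * w a"
    using insert.hyps by (simp add: s'_def t_def)
  moreover have "\<bar>t + e * w a\<bar> = \<bar>\<bar>t\<bar> - w a\<bar>"
    by (auto simp: e_def)
  \<comment> \<open>Once below \<theta> the partial sum stays there. Before that, either the step
    shrinks it by the full \<open>w a\<close> or it passes \<open>0\<close> and lands below
    \<theta>.\<close>
  moreover have "\<bar>\<bar>t\<bar> - w a\<bar> < \<theta> \<or> \<bar>\<bar>t\<bar> - w a\<bar> \<le> \<bar>r\<bar> - sum w (insert a S)"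
    using le a insert.hyps unfolding t_def[symmetric] by auto
  ultimately show ?case
    using s by (intro exI[of _ s']) (auto simp: s'_def e_def)
qed

text \<open>The signs minimise the absolute sum, and \<open>L\<close> collects the weights that are
  at least the minimum \<theta>. Greedy signs on \<open>A - L\<close> cannot get below \<theta>, so
  they subtract all of \<open>sum w (A - L)\<close> from any signed sum over \<open>L\<close>. If
  \<theta> exceeds \<open>N / 2\<close>, pairing rules out even \<open>card L\<close>, and for odd
  \<open>card L\<close> it gives a signed sum over \<open>L\<close> of at most
  \<open>N\<close>.\<close>

lemma minimal_signs:
  fixes w :: "'a \<Rightarrow> real"
  assumes fin: "finite A" and w: "\<And>a. a \<in> A \<Longrightarrow> 0 \<le> w a \<and> w a \<le> N" and N: "0 \<le> N"
  shows "\<exists>s \<theta>. (\<forall>a. s a = 1 \<or> s a = - 1) \<and> \<theta> = \<bar>\<Sum>a\<in>A. s a * w a\<bar> \<and>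
    (\<theta> \<le> N / 2 \<or> (\<exists>L\<subseteq>A. odd (card L) \<and> (\<forall>a\<in>L. \<theta> \<le> w a) \<and> \<theta> + sum w (A - L) \<le> N))"
proof -
  define T where "T = (\<lambda>P. \<bar>(\<Sum>a\<in>A. (if a \<in> P then 1 else - 1) * w a)\<bar>) ` Pow A"
  have T: "finite T" "T \<noteq> {}"
    using fin by (auto simp: T_def)
  obtain P where P: "Min T = \<bar>(\<Sum>a\<in>A. (if a \<in> P then 1 else - 1) * w a)\<bar>"
    using Min_in[OF T] by (auto simp: T_def)
  define s where "s a = (if a \<in> P then 1 else - 1 :: real)" for a
  define \<theta> where "\<theta> = Min T"
  have min: "\<theta> \<le> \<bar>\<Sum>a\<in>A. s' a * w a\<bar>" if s': "\<forall>a. s' a = 1 \<or> s' a = - 1" for s'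
  proof -
    have "(\<Sum>a\<in>A. s' a * w a) = (\<Sum>a\<in>A. (if a \<in> {a \<in> A. s' a = 1} then 1 else - 1) * w a)"
      using s' by (intro sum.cong) auto
    then have "\<bar>\<Sum>a\<in>A. s' a * w a\<bar> \<in> T"
      unfolding T_def by (intro image_eqI[of _ _ "{a \<in> A. s' a = 1}"]) auto
    then show ?thesis
      using T by (simp add: \<theta>_def)
  qed
  have "\<exists>L\<subseteq>A. odd (card L) \<and> (\<forall>a\<in>L. \<theta> \<le> w a) \<and> \<theta> + sum w (A - L) \<le> N" if large: "N / 2 < \<theta>"
  proof -
    define L where "L = {a \<in> A. \<theta> \<le> w a}"
    have L: "L \<subseteq> A" "finite L" "\<And>a. a \<in> L \<Longrightarrow> \<theta> \<le> w a \<and> w a \<le> N"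
      using fin w by (auto simp: L_def)
    have rest: "\<theta> \<le> \<bar>\<Sum>a\<in>L. t a * w a\<bar> - sum w (A - L)"
      if t: "\<forall>a. t a = 1 \<or> t a = - 1" for t
    proof -
      obtain t' where t': "\<forall>a. t' a = 1 \<or> t' a = - 1"
        and le: "\<bar>(\<Sum>a\<in>L. t a * w a) + (\<Sum>a\<in>A - L. t' a * w a)\<bar> < \<theta> \<or>
          \<bar>(\<Sum>a\<in>L. t a * w a) + (\<Sum>a\<in>A - L. t' a * w a)\<bar> \<le> \<bar>\<Sum>a\<in>L. t a * w a\<bar> - sum w (A - L)"
        using signed_sum_greedy[of "A - L" w \<theta> "\<Sum>a\<in>L. t a * w a"] fin w
        by (auto simp: L_def not_le)
      define u where "u a = (if a \<in> L then t a else t' a)" for a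
      have "(\<Sum>a\<in>A. u a * w a) = (\<Sum>a\<in>A - L. u a * w a) + (\<Sum>a\<in>L. u a * w a)"
        using fin L(1) by (intro sum.subset_diff) auto
      also have "\<dots> = (\<Sum>a\<in>L. t a * w a) + (\<Sum>a\<in>A - L. t' a * w a)"
        by (simp add: u_def)
      finally have "\<theta> \<le> \<bar>(\<Sum>a\<in>L. t a * w a) + (\<Sum>a\<in>A - L. t' a * w a)\<bar>"
        using min[of u] t t' by (auto simp: u_def)
      then show ?thesis
        using le by linarith
    qed
    have nonneg: "0 \<le> sum w (A - L)"
      using w by (intro sum_nonneg) auto
    have "odd (card L)"
    proof
      assume "even (card L)"
      then obtain k where k: "card L = 2 * k"
        by (elim evenE)
      show False
      proof (cases "L = {}")
        case True
        then show False
          using rest[of "\<lambda>_. 1"] nonneg large N by simp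
      next
        case False
        then have "\<theta> \<le> N"
          using L(3) by force
        then obtain t where "\<forall>a. t a = 1 \<or> t a = - 1" "\<bar>\<Sum>a\<in>L. t a * w a\<bar> \<le> N - \<theta>"
          using signed_sum_even[OF L(2) k, of \<theta> w N] L(3) by auto
        then show False
          using rest[of t] nonneg large by auto
      qed
    qed
    moreover have "\<theta> + sum w (A - L) \<le> N"
    proof -
      obtain k where k: "card L = Suc (2 * k)"
        using \<open>odd (card L)\<close> by (auto elim: oddE)
      obtain a L1 where L1: "L = insert a L1" "a \<notin> L1" "card L1 = 2 * k"
        using k card_Suc_eq[of L "2 * k"] by auto
      have "finite L1" "\<theta> \<le> w a" "w a \<le> N"
        using L L1 by auto
      then obtain t where t: "\<forall>a. t a = 1 \<or> t a = - 1" and le: "\<bar>\<Sum>a\<in>L1. t a * w a\<bar> \<le> N - \<theta>"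
        using signed_sum_even[of L1 k \<theta> w N] L1 L(3) order_trans[of \<theta> "w a" N] by auto
      define r where "r = (\<Sum>a\<in>L1. t a * w a)"
      \<comment> \<open>The unpaired element opposes the paired sum \<open>r\<close>, so the result
        is bounded by the larger of \<open>w a\<close> and \<open>\<bar>r\<bar>\<close>.\<close>
      define e :: real where "e = (if 0 \<le> r then - 1 else 1)"
      define t' where "t' = t(a := e)"
      have "(\<Sum>b\<in>L1. t' b * w b) = r"
        unfolding r_def using L1 by (intro sum.cong) (auto simp: t'_def)
      then have "(\<Sum>b\<in>L. t' b * w b) = e * w a + r"
        using L1 \<open>finite L1\<close> by (simp add: t'_def)
      moreover have "\<bar>e * w a + r\<bar> \<le> N"
        using le \<open>\<theta> \<le> w a\<close> \<open>w a \<le> N\<close> large N unfolding r_def[symmetric] e_def by auto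
      moreover have "\<theta> \<le> \<bar>\<Sum>b\<in>L. t' b * w b\<bar> - sum w (A - L)"
        by (rule rest) (use t in \<open>simp add: t'_def e_def\<close>)
      ultimately show ?thesis
        by simp
    qed
    ultimately show ?thesis
      using L(1,3) by blast
  qed
  then have "\<theta> \<le> N / 2 \<or> (\<exists>L\<subseteq>A. odd (card L) \<and> (\<forall>a\<in>L. \<theta> \<le> w a) \<and> \<theta> + sum w (A - L) \<le> N)"
    using not_le_imp_less by blast
  moreover have "\<forall>a. s a = 1 \<or> s a = - 1"
    by (simp add: s_def)
  moreover have "\<theta> = \<bar>\<Sum>a\<in>A. s a * w a\<bar>"
    using P by (simp add: s_def \<theta>_def)
  ultimately show ?thesis
    by (intro exI[of _ s] exI[of _ \<theta>] conjI)
qed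

subsection \<open>The counting inequality\<close>

text \<open>A charging bound, used with \<open>T z\<close> the closed neighbourhood of
  \<open>z\<close> in \<open>B\<close>: the weights then need checking only locally.\<close>

lemma sum_disjoint_family_ge:
  fixes f :: "'a \<Rightarrow> int"
  assumes "finite B" "finite Z" and T: "\<And>z. z \<in> Z \<Longrightarrow> T z \<subseteq> B"
    and disj: "\<And>z z'. z \<in> Z \<Longrightarrow> z' \<in> Z \<Longrightarrow> z \<noteq> z' \<Longrightarrow> T z \<inter> T z' = {}"
    and nonneg: "\<And>v. v \<in> B \<Longrightarrow> 0 \<le> f v" and ge: "\<And>z. z \<in> Z \<Longrightarrow> k \<le> sum f (T z)"
  shows "k * int (card Z) \<le> sum f B"
proof -
  have "k * int (card Z) = (\<Sum>z\<in>Z. k)"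
    by simp
  also have "\<dots> \<le> (\<Sum>z\<in>Z. sum f (T z))"
    by (rule sum_mono[OF ge])
  also have "\<dots> = sum f (\<Union>z\<in>Z. T z)"
    using assms finite_subset[OF T] by (subst sum.UNION_disjoint) auto
  also have "\<dots> \<le> sum f B"
    using assms by (intro sum_mono2) auto
  finally show ?thesis .
qed

context simple_graph
begin

text \<open>A linear combination of the bounds on \<theta> and on the edge count reduces the claim
  to vertex weights on \<open>B\<close> that are nonnegative and sum to at least
  \<open>D + 1\<close> on the closed neighbourhood of every \<open>z\<close> in \<open>Z\<close>.
  The weights depend on the size of \<open>L\<close>.\<close>

lemma key_inequality:
  fixes \<delta> :: nat and \<theta> :: real
  assumes \<delta>: "0 < \<delta>" "even \<delta>" and min_deg: "\<And>v. v \<in> V \<Longrightarrow> \<delta> \<le> vertex_degree E v"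
    and B: "B \<subseteq> V" and Z: "Z \<subseteq> B"
    and disj: "\<And>z z'. z \<in> Z \<Longrightarrow> z' \<in> Z \<Longrightarrow> z \<noteq> z' \<Longrightarrow>
      insert z {v \<in> B. adj z v} \<inter> insert z' {v \<in> B. adj z' v} = {}"
    and even: "\<And>z w. z \<in> Z \<Longrightarrow> w \<in> insert z {v \<in> B. adj z v} \<Longrightarrow> even (card {v \<in> B. adj w v})"
    and \<theta>: "0 \<le> \<theta>" "\<theta> \<le> real (card B) / 2 \<or> (\<exists>L\<subseteq>V - B. odd (card L) \<and>
      (\<forall>a\<in>L. \<theta> \<le> (\<Sum>v\<in>B. wt a v)) \<and> \<theta> + (\<Sum>a\<in>V - B - L. \<Sum>v\<in>B. wt a v) \<le> real (card B))"
  shows "2 * (real \<delta> + 1) * \<theta> \<le> 2 * real (card E) + (real \<delta> + 1) * (real (card B) - real (card Z))"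
proof -
  have fin: "finite B" "finite Z" "finite (V - B)"
    using B Z finite_vertices by (auto intro: finite_subset)
  define nb where "nb U v = int (card {u \<in> U. adj v u})" for U v
  define T where "T z = insert z {v \<in> B. adj z v}" for z
  define n where "n = int (card B)"
  define D where "D = int \<delta>"
  have D: "2 \<le> D" "even D"
    using \<delta> by (auto simp: D_def elim!: evenE)
  have nb_wt: "real_of_int (nb U v) = (\<Sum>u\<in>U. wt v u)" if "finite U" for U v
    using that by (simp add: nb_def sum_wt)
  have nb_nonneg: "0 \<le> nb U v" for U v
    by (simp add: nb_def)
  have nb_le: "nb U v \<le> int (card U)" if "finite U" for U v
    unfolding nb_def using that by (auto intro!: card_mono)
  have nb_Un: "nb (U \<union> W) v = nb U v + nb W v" if "finite U" "finite W" "U \<inter> W = {}" for U W v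
  proof -
    have "{u \<in> U \<union> W. adj v u} = {u \<in> U. adj v u} \<union> {u \<in> W. adj v u}"
      by auto
    then show ?thesis
      using that by (simp add: nb_def card_Un_disjnt disjnt_def Int_def) (subst card_Un_disjoint, auto)
  qed
  have nb_V: "nb V v = nb (V - B) v + nb B v" for v
  proof -
    have "V = (V - B) \<union> B" "(V - B) \<inter> B = {}"
      using B by auto
    then show ?thesis
      using nb_Un[of "V - B" B v] fin by simp
  qed
  have deg_ge: "D \<le> nb (V - B) v + nb B v" if "v \<in> B" for v
  proof -
    have "int (vertex_degree E v) = nb V v"
      by (simp add: nb_def vertex_degree_eq)
    then show ?thesis
      using min_deg[of v] that B nb_V[of v] by (auto simp: D_def)
  qed
  have T: "finite (T z)" "T z \<subseteq> B" "int (card (T z)) = nb B z + 1" "z \<in> T z" if "z \<in> Z" for z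
    using that Z fin adj_irrefl by (auto simp: T_def nb_def)
  have sum_T: "f v \<le> sum f (T z)" if "z \<in> Z" "v \<in> T z" "\<And>v. v \<in> B \<Longrightarrow> 0 \<le> f v" for z v and f :: "'a \<Rightarrow> int"
    using that T[OF that(1)] by (intro member_le_sum) auto
  have sum_T_const: "k * (nb B z + 1) \<le> sum f (T z)" if "z \<in> Z" "\<And>v. v \<in> T z \<Longrightarrow> k \<le> f v" for z k and f :: "'a \<Rightarrow> int"
  proof -
    have "(\<Sum>v\<in>T z. k) \<le> sum f (T z)"
      by (rule sum_mono) (rule that)
    then show ?thesis
      using T(3)[OF that(1)] by (simp add: mult.commute)
  qed
  have swap: "real_of_int (\<Sum>v\<in>B. nb U v) = (\<Sum>a\<in>U. \<Sum>v\<in>B. wt a v)" if "finite U" for U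
    using that by (simp add: nb_wt) (subst sum.swap, simp add: wt_sym)
  have edges: "real_of_int (\<Sum>v\<in>B. 2 * nb (V - B) v + nb B v) \<le> 2 * real (card E)"
  proof -
    have "(\<Sum>v\<in>V. deg v) = (\<Sum>v\<in>V - B. deg v) + (\<Sum>v\<in>B. deg v)"
      using B finite_vertices by (intro sum.subset_diff) auto
    also have "(\<Sum>v\<in>B. deg v) = real_of_int (\<Sum>v\<in>B. nb (V - B) v + nb B v)"
    proof -
      have "deg v = real_of_int (nb (V - B) v + nb B v)" for v
        unfolding nb_V[symmetric] by (simp add: deg_def vertex_degree_eq nb_def)
      then show ?thesis
        by simp
    qed
    also have "(\<Sum>v\<in>V - B. deg v) \<ge> (\<Sum>a\<in>V - B. \<Sum>v\<in>B. wt a v)"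
      unfolding deg_eq using B finite_vertices by (intro sum_mono sum_mono2) (auto simp: wt_nonneg)
    ultimately show ?thesis
      using swap[OF fin(3)] by (simp add: sum_deg sum.distrib sum_distrib_left[symmetric])
  qed
  have ZT: "k * int (card Z) \<le> sum f B"
    if "\<And>v. v \<in> B \<Longrightarrow> 0 \<le> f v" "\<And>z. z \<in> Z \<Longrightarrow> k \<le> sum f (T z)" for k and f :: "'a \<Rightarrow> int"
    using that fin T disj by (intro sum_disjoint_family_ge[where T = T]) (auto simp: T_def)
  have ZB: "card Z \<le> card B"
    using fin Z by (intro card_mono)
  consider "\<theta> \<le> real (card B) / 2" | L where "L \<subseteq> V - B" "odd (card L)"
    "\<And>a. a \<in> L \<Longrightarrow> \<theta> \<le> (\<Sum>v\<in>B. wt a v)" "\<theta> + (\<Sum>a\<in>V - B - L. \<Sum>v\<in>B. wt a v) \<le> real (card B)"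
    using \<theta>(2) by blast
  then show ?thesis
  proof cases
    case 1
    have "(D + 1) * int (card Z) \<le> (\<Sum>v\<in>B. 2 * nb (V - B) v + nb B v)"
    proof (rule ZT)
      fix z assume z: "z \<in> Z"
      then have zB: "z \<in> B"
        using Z by auto
      let ?f = "\<lambda>v. 2 * nb (V - B) v + nb B v"
      have f: "0 \<le> ?f v" for v
        using nb_nonneg by simp
      show "D + 1 \<le> sum ?f (T z)"
      \<comment> \<open>A neighbour outside \<open>B\<close> counts twice, so \<open>z\<close> alone
        reaches \<open>D + 1\<close>. Otherwise \<open>z\<close> has at least \<open>D\<close>
        neighbours in \<open>B\<close>, each of weight at least 1 because of its edge to
        \<open>z\<close>.\<close>
      proof (cases "nb (V - B) z = 0")
        case False
        then have "D + 1 \<le> ?f z"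
          using deg_ge[OF zB] nb_nonneg[of "V - B" z] by linarith
        then show ?thesis
          by (rule order_trans[OF _ sum_T[OF z T(4)[OF z]]]) (use f in blast)
      next
        case True
        then have "D \<le> nb B z"
          using deg_ge[OF zB] by simp
        moreover have "1 \<le> ?f v" if "v \<in> T z" for v
        proof (cases "v = z")
          case False
          then have "z \<in> {u \<in> B. adj v u}"
            using that zB adj_sym by (auto simp: T_def)
          then have "card {u \<in> B. adj v u} \<noteq> 0"
            using fin by auto
          then show ?thesis
            using nb_nonneg[of "V - B" v] by (simp add: nb_def)
        qed (use \<open>D \<le> nb B z\<close> True D in simp)
        ultimately show ?thesis
          using sum_T_const[OF z, of 1 ?f] by simp
      qed
    qed (use nb_nonneg in simp)
    then have "real_of_int ((D + 1) * int (card Z)) \<le> real_of_int (\<Sum>v\<in>B. 2 * nb (V - B) v + nb B v)"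
      by (simp only: of_int_le_iff)
    then have "(real \<delta> + 1) * real (card Z) \<le> 2 * real (card E)"
      using edges by (simp add: D_def)
    moreover have "2 * (real \<delta> + 1) * \<theta> \<le> (real \<delta> + 1) * real (card B)"
      using 1 mult_left_mono[of "2 * \<theta>" "real (card B)" "real \<delta> + 1"] by (simp add: algebra_simps)
    ultimately show ?thesis
      by (simp add: algebra_simps)
  next
    case (2 L)
    define l where "l = int (card L)"
    have finL: "finite L" "finite (V - B - L)"
      using 2(1) fin by (auto intro: finite_subset)
    define al sg where "al = nb L" and "sg = nb (V - B - L)"
    define Al Sg Db where "Al = (\<Sum>v\<in>B. al v)" and "Sg = (\<Sum>v\<in>B. sg v)" and "Db = (\<Sum>v\<in>B. nb B v)"
    have split: "nb (V - B) v = al v + sg v" for v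
    proof -
      have "V - B = L \<union> (V - B - L)"
        using 2(1) by auto
      then show ?thesis
        using nb_Un[of L "V - B - L" v] finL by (simp add: al_def sg_def)
    qed
    have l: "1 \<le> l" "odd l" "al v \<le> l" for v
      using 2(2) nb_le[OF finL(1)] by (auto simp: l_def al_def intro: Suc_leI dest: odd_pos)
    have nonneg: "0 \<le> al v" "0 \<le> sg v" "0 \<le> nb B v" for v
      using nb_nonneg by (auto simp: al_def sg_def)
    have dg: "D \<le> al v + sg v + nb B v" if "v \<in> B" for v
      using deg_ge[OF that] split[of v] by simp
    have evenB: "even (nb B v)" if "z \<in> Z" "v \<in> T z" for z v
      using even that by (simp add: nb_def T_def)
    have E: "real_of_int (2 * Al + 2 * Sg + Db) \<le> 2 * real (card E)"
      using edges by (simp add: split Al_def Sg_def Db_def sum.distrib sum_distrib_left algebra_simps)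
    have lA: "real_of_int l * \<theta> \<le> real_of_int Al"
    proof -
      have "real_of_int Al = (\<Sum>a\<in>L. \<Sum>v\<in>B. wt a v)"
        using swap[OF finL(1)] by (simp add: Al_def al_def)
      moreover have "(\<Sum>a\<in>L. \<theta>) \<le> (\<Sum>a\<in>L. \<Sum>v\<in>B. wt a v)"
        by (intro sum_mono 2(3))
      ultimately show ?thesis
        by (simp add: l_def)
    qed
    have sS: "\<theta> + real_of_int Sg \<le> real_of_int n"
      using swap[OF finL(2)] 2(4) by (simp add: Sg_def sg_def n_def)
    text \<open>Combining \<open>l * \<theta> \<le> Al\<close> with weight \<open>y / l\<close> and \<open>\<theta> \<le> n - Sg\<close> with weight \<open>2 * D + 2 - y\<close>
      leaves a sum over \<open>B\<close> of nonnegative vertex weights.\<close>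
    have finish: ?thesis
      if y: "x * l = y" "0 \<le> x" "y \<le> 2 * D + 2"
        and f: "\<And>v. v \<in> B \<Longrightarrow> 0 \<le> (2 - x) * al v + (2 * D + 4 - y) * sg v + nb B v - D - 1 + y"
        and fT: "\<And>z. z \<in> Z \<Longrightarrow>
          D + 1 \<le> (\<Sum>v\<in>T z. (2 - x) * al v + (2 * D + 4 - y) * sg v + nb B v - D - 1 + y)"
      for x y
    proof -
      have "(D + 1) * int (card Z) \<le> (\<Sum>v\<in>B. (2 - x) * al v + (2 * D + 4 - y) * sg v + nb B v - D - 1 + y)"
        using f fT by (rule ZT)
      also have "\<dots> = (\<Sum>v\<in>B. (2 - x) * al v + (2 * D + 4 - y) * sg v + nb B v + (y - D - 1))"
        by (intro sum.cong) auto
      also have "\<dots> = (2 - x) * Al + (2 * D + 4 - y) * Sg + Db + n * (y - D - 1)"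
        by (simp add: sum.distrib sum_distrib_left Al_def Sg_def Db_def n_def)
      finally have "real_of_int ((D + 1) * int (card Z))
          \<le> real_of_int ((2 - x) * Al + (2 * D + 4 - y) * Sg + Db + n * (y - D - 1))"
        by (simp only: of_int_le_iff)
      moreover have "real_of_int y * \<theta> \<le> real_of_int x * real_of_int Al"
        unfolding y(1)[symmetric] of_int_mult mult.assoc using lA y(2)
        by (intro mult_left_mono) auto
      moreover have "real_of_int (2 * D + 2 - y) * (\<theta> + real_of_int Sg) \<le> real_of_int (2 * D + 2 - y) * real_of_int n"
        using sS y(3) by (intro mult_left_mono) (simp_all only: of_int_0_le_iff)
      ultimately show ?thesis
        using E by (simp add: D_def n_def algebra_simps)
    qed
    \<comment> \<open>Parity excludes \<open>l = D\<close>.\<close>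
    have "D + 1 \<le> l \<or> l = 1 \<or> 3 \<le> l \<and> l \<le> D - 1"
      using l(1,2) D(2) by presburger
    then consider "D + 1 \<le> l" | "l = 1" | "3 \<le> l" "l \<le> D - 1"
      by blast
    then show ?thesis
    proof cases
      case 1
      \<comment> \<open>For large \<open>L\<close> the chain
        \<open>(D + 1) * \<theta> \<le> l * \<theta> \<le> Al\<close> suffices, as \<open>Al\<close>
        is at most the number of edges.\<close>
      have "0 \<le> Sg" "0 \<le> Db"
        using nonneg by (auto simp: Sg_def Db_def intro: sum_nonneg)
      then have "0 \<le> real_of_int Sg" "0 \<le> real_of_int Db"
        by simp_all
      moreover have "(real \<delta> + 1) * \<theta> \<le> real_of_int l * \<theta>"
        using 1 \<theta>(1) by (intro mult_right_mono) (auto simp: D_def)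
      moreover have "2 * (real \<delta> + 1) * \<theta> = 2 * ((real \<delta> + 1) * \<theta>)"
        by simp
      moreover have "0 \<le> (real \<delta> + 1) * (real (card B) - real (card Z))"
        using ZB by simp
      ultimately show ?thesis
        using lA E by linarith
    next
      case l1: 2
      have f: "0 \<le> (2 - 2) * al v + (2 * D + 4 - 2) * sg v + nb B v - D - 1 + 2" if "v \<in> B" for v
      proof -
        have "1 * sg v \<le> (2 * D + 4 - 2) * sg v"
          using D nonneg(2)[of v] by (intro mult_right_mono) auto
        then show ?thesis
          using dg[OF that] l(3)[of v] l1 by (simp add: algebra_simps)
      qed
      show ?thesis
      proof (rule finish[of 2 2])
        fix z assume z: "z \<in> Z"
        let ?f = "\<lambda>v. (2 - 2) * al v + (2 * D + 4 - 2) * sg v + nb B v - D - 1 + 2"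
        show "D + 1 \<le> sum ?f (T z)"
        proof (cases "\<exists>v\<in>T z. sg v \<noteq> 0")
          case True
          then obtain v where v: "v \<in> T z" "sg v \<noteq> 0"
            by blast
          then have "(2 * D + 4 - 2) * 1 \<le> (2 * D + 4 - 2) * sg v"
            using nonneg(2)[of v] D by (intro mult_left_mono) auto
          then have "D + 1 \<le> ?f v"
            using nonneg(3)[of v] D by (simp add: algebra_simps)
          then show ?thesis
            by (rule order_trans[OF _ sum_T[OF z v(1)]]) (use f in blast)
        next
          case False
          \<comment> \<open>The degree bound leaves \<open>D - 1\<close> as the least value; this is
            odd while degrees in \<open>B\<close> are even on \<open>T z\<close>, so one more
            neighbour is gained.\<close>
          have D_le: "D \<le> nb B v" if "v \<in> T z" for v
          proof -
            have "D - 1 \<le> nb B v"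
              using dg[of v] T(2)[OF z] that False l(3)[of v] l1 by auto
            moreover have "nb B v \<noteq> D - 1"
              using evenB[OF z that] D by auto
            ultimately show ?thesis
              by simp
          qed
          have "1 \<le> ?f v" if "v \<in> T z" for v
            using D_le[OF that] False that by simp
          then have "1 * (nb B z + 1) \<le> sum ?f (T z)"
            by (rule sum_T_const[OF z])
          then show ?thesis
            using D_le[OF T(4)[OF z]] by simp
        qed
      qed (use f l1 D in auto)
    next
      case l3: 3
      have f: "0 \<le> (2 - 1) * al v + (2 * D + 4 - l) * sg v + nb B v - D - 1 + l"
        "l - 1 \<le> (2 - 1) * al v + (2 * D + 4 - l) * sg v + nb B v - D - 1 + l" if "v \<in> B" for v
      proof -
        have "1 * sg v \<le> (2 * D + 4 - l) * sg v"
          using D nonneg(2)[of v] l3 by (intro mult_right_mono) auto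
        then show "0 \<le> (2 - 1) * al v + (2 * D + 4 - l) * sg v + nb B v - D - 1 + l"
          "l - 1 \<le> (2 - 1) * al v + (2 * D + 4 - l) * sg v + nb B v - D - 1 + l"
          using dg[OF that] l3 by (simp_all add: algebra_simps)
      qed
      show ?thesis
      proof (rule finish[of 1 l])
        fix z assume z: "z \<in> Z"
        let ?f = "\<lambda>v. (2 - 1) * al v + (2 * D + 4 - l) * sg v + nb B v - D - 1 + l"
        show "D + 1 \<le> sum ?f (T z)"
        proof (cases "\<exists>v\<in>T z. sg v \<noteq> 0")
          case True
          then obtain v where v: "v \<in> T z" "sg v \<noteq> 0"
            by blast
          then have "(2 * D + 4 - l) * 1 \<le> (2 * D + 4 - l) * sg v"
            using nonneg(2)[of v] D l3 by (intro mult_left_mono) auto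
          then have "D + 1 \<le> ?f v"
            using nonneg(1,3)[of v] D l3 by (simp add: algebra_simps)
          then show ?thesis
            by (rule order_trans[OF _ sum_T[OF z v(1)]]) (use f in blast)
        next
          case False
          have "D - l \<le> nb B z"
            using dg[of z] T(2,4)[OF z] False l(3)[of z] by auto
          moreover have "nb B z \<noteq> D - l"
            using evenB[OF z T(4)[OF z]] D l(2) by auto
          ultimately have "D - l + 2 \<le> nb B z + 1"
            by simp
          then have "(l - 1) * (D - l + 2) \<le> (l - 1) * (nb B z + 1)"
            using l3 by (intro mult_left_mono) auto
          also have "\<dots> \<le> sum ?f (T z)"
            using f(2) T(2)[OF z] by (intro sum_T_const[OF z]) auto
          finally have "(l - 1) * (D - l + 2) \<le> sum ?f (T z)" .
          \<comment> \<open>The product \<open>(l - 1) * (D - l + 2)\<close> exceeds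
            \<open>D + 1\<close> by \<open>(l - 3) * (D - 1 - l) + (l + D - 6)\<close>, and
            \<open>4 \<le> D\<close> here.\<close>
          moreover have "0 \<le> (l - 3) * (D - 1 - l)"
            using l3 by simp
          then have "D + 1 \<le> (l - 1) * (D - l + 2)"
            using l3 by (simp add: algebra_simps)
          ultimately show ?thesis
            by simp
        qed
      qed (use f l3 D in auto)
    qed
  qed
qed

end

subsection \<open>Judicious bisections\<close>

context simple_graph
begin

text \<open>Error budget: \<open>S\<close> costs \<open>3 * \<rho> / 4\<close> and the cross terms
  \<open>\<rho> / 4\<close>, together \<rho>. The imbalance is at most \<open>3 * \<rho>\<close>
  from \<open>B\<close> and \<rho> from \<open>V - B\<close>; repairing \<open>4 * \<rho>\<close>
  costs \<open>16 * \<rho>\<close>.\<close>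

lemma bisection_of_clusters:
  fixes c :: "'a \<Rightarrow> 'k" and h :: "'a \<Rightarrow> real"
  assumes B: "B \<subseteq> V" and h: "\<And>v. h v = 1 \<or> h v = - 1"
    and \<rho>: "0 < \<rho>" "\<rho> \<le> 1 / 8" and n: "0 < card V" "0 < card E"
    and const: "\<And>u v. u \<in> V - B \<Longrightarrow> v \<in> V - B \<Longrightarrow> c u = c v"
    and deg_small: "(\<Sum>u\<in>B. \<Sum>v | v \<in> B \<and> c v = c u. deg u * deg v) \<le> \<rho> ^ 3 * real (card E) ^ 2"
    and card_small: "(\<Sum>u\<in>B. real (card {v \<in> B. c v = c u})) \<le> \<rho> ^ 3 * real (card V) ^ 2"
    and A: "real (card (V - B)) \<le> \<rho> * real (card V)"
    and K: "real (card E) / 4 + \<bar>\<Sum>v\<in>V - B. deg v * h v\<bar> / 4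
      + (\<Sum>u\<in>V. \<Sum>v | v \<in> V \<and> c v = c u. wt u v * h u * h v) / 8 \<le> K"
  shows "\<exists>V1 V2. bisection V V1 V2 \<and>
    real (edges_within E V1) \<le> K + 17 * \<rho> * real (card E) \<and>
    real (edges_within E V2) \<le> K + 17 * \<rho> * real (card E)"
proof -
  have "\<rho> \<le> 1"
    using \<rho> by simp
  from balanced_signs[where h = h and c = c, OF B h \<rho>(1) this n const deg_small card_small]
  obtain x where x: "\<And>v. x v = 1 \<or> x v = - 1"
    and Q: "(\<Sum>u\<in>V. \<Sum>v\<in>V. wt u v * x u * x v)
      \<le> (\<Sum>u\<in>V. \<Sum>v | v \<in> V \<and> c v = c u. wt u v * h u * h v) + 2 * \<rho> * real (card E)"
    and S: "\<bar>\<Sum>v\<in>B. deg v * x v\<bar> \<le> 3 * \<rho> * real (card E)"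
    and N: "\<bar>\<Sum>v\<in>B. x v\<bar> \<le> 3 * \<rho> * real (card V)"
    and SA: "\<bar>\<Sum>v\<in>V - B. deg v * x v\<bar> = \<bar>\<Sum>v\<in>V - B. deg v * h v\<bar>"
    by auto
  define side where "side e = {v \<in> V. x v = e}" for e
  have split: "sum f V = sum f (V - B) + sum f B" for f :: "'a \<Rightarrow> real"
    using B finite_vertices by (rule sum.subset_diff)
  have e: "real (edges_within E (side e)) \<le> K + \<rho> * real (card E)" if "e = 1 \<or> e = - 1" for e
  proof -
    have "e * (\<Sum>v\<in>V. deg v * x v) \<le> \<bar>\<Sum>v\<in>V - B. deg v * h v\<bar> + 3 * \<rho> * real (card E)"
      using that S SA split[of "\<lambda>v. deg v * x v"] by auto
    then show ?thesis
      using edges_within_sign[of x e, OF x that] Q K unfolding side_def by simp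
  qed
  have "(\<Sum>v\<in>V. x v) = (\<Sum>v\<in>side 1. x v) + (\<Sum>v\<in>side (- 1). x v)"
    using x finite_vertices
    by (subst sum.union_disjoint[symmetric]) (auto simp: side_def intro!: sum.cong)
  also have "\<dots> = real (card (side 1)) - real (card (side (- 1)))"
    by (simp add: side_def)
  finally have "real (card (side 1)) - real (card (side (- 1))) = (\<Sum>v\<in>V - B. x v) + (\<Sum>v\<in>B. x v)"
    using split[of x] by simp
  moreover have "\<bar>\<Sum>v\<in>V - B. x v\<bar> \<le> real (card (V - B))"
  proof -
    have "\<bar>x v\<bar> = 1" for v
      using x[of v] by auto
    then show ?thesis
      using sum_abs[of x "V - B"] by simp
  qed
  ultimately have "\<bar>real (card (side 1)) - real (card (side (- 1)))\<bar> \<le> 4 * \<rho> * real (card V)"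
    using N A by linarith
  moreover have "side 1 \<union> side (- 1) = V" "side 1 \<inter> side (- 1) = {}"
    using x by (auto simp: side_def)
  ultimately obtain W1 W2 where "bisection V W1 W2"
    "real (edges_within E W1) \<le> real (edges_within E (side 1)) + 4 * (4 * \<rho>) * real (card E)"
    "real (edges_within E W2) \<le> real (edges_within E (side (- 1))) + 4 * (4 * \<rho>) * real (card E)"
    using rebalance[of "side 1" "side (- 1)" "4 * \<rho>"] \<rho> n by auto
  then show ?thesis
    using e[of 1] e[of "- 1"] by (intro exI[of _ W1] exI[of _ W2]) auto
qed

text \<open>Singleton clusters contain no edges, and their degree condition holds because the
  squared degrees sum to at most \<open>card V\<close> times the degree sum.\<close>

lemma bisection_dense:
  assumes \<rho>: "0 < \<rho>" "\<rho> \<le> 1 / 8" and n: "0 < card V" "0 < card E"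
    and large: "1 \<le> \<rho> ^ 3 * real (card V)" and dense: "2 * real (card V) \<le> \<rho> ^ 3 * real (card E)"
  shows "\<exists>V1 V2. bisection V V1 V2 \<and>
    real (edges_within E V1) \<le> real (card E) / 4 + 17 * \<rho> * real (card E) \<and>
    real (edges_within E V2) \<le> real (card E) / 4 + 17 * \<rho> * real (card E)"
proof (rule bisection_of_clusters[where B = V and c = id and h = "\<lambda>_. 1", OF _ _ \<rho> n])
  have sing: "{v. v \<in> V \<and> id v = id u} = {u}" if "u \<in> V" for u
    using that by auto
  have "(\<Sum>u\<in>V. \<Sum>v | v \<in> V \<and> id v = id u. deg u * deg v) = (\<Sum>u\<in>V. deg u * deg u)"
    by (intro sum.cong refl) (simp only: sing, simp)
  also have "\<dots> \<le> (\<Sum>u\<in>V. real (card V) * deg u)"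
    by (intro sum_mono mult_right_mono) (auto simp: deg_le deg_nonneg)
  also have "\<dots> = 2 * real (card V) * real (card E)"
    by (simp add: sum_distrib_left[symmetric] sum_deg)
  also have "\<dots> \<le> \<rho> ^ 3 * real (card E) * real (card E)"
    using dense by (intro mult_right_mono) auto
  finally show "(\<Sum>u\<in>V. \<Sum>v | v \<in> V \<and> id v = id u. deg u * deg v) \<le> \<rho> ^ 3 * real (card E) ^ 2"
    by (simp add: power2_eq_square mult.assoc)
  have "(\<Sum>u\<in>V. real (card {v \<in> V. id v = id u})) = (\<Sum>u\<in>V. 1)"
    by (intro sum.cong refl) (simp only: sing, simp)
  also have "\<dots> \<le> \<rho> ^ 3 * real (card V) * real (card V)"
    using large mult_right_mono[of 1 "\<rho> ^ 3 * real (card V)" "real (card V)"] by simp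
  finally show "(\<Sum>u\<in>V. real (card {v \<in> V. id v = id u})) \<le> \<rho> ^ 3 * real (card V) ^ 2"
    by (simp add: power2_eq_square mult.assoc)
  have "(\<Sum>u\<in>V. \<Sum>v | v \<in> V \<and> id v = id u. wt u v * 1 * 1) = (\<Sum>u\<in>V. 0)"
    by (intro sum.cong refl) (simp only: sing, simp add: wt_def adj_irrefl)
  then show "real (card E) / 4 + \<bar>\<Sum>v\<in>V - V. deg v * 1\<bar> / 4
      + (\<Sum>u\<in>V. \<Sum>v | v \<in> V \<and> id v = id u. wt u v * 1 * 1) / 8 \<le> real (card E) / 4"
    by simp
qed (use \<rho> in auto)

lemma star_clusters_cut:
  assumes "finite B" and Lf: "Lf \<subseteq> B" and leaf: "\<And>v. v \<in> Lf \<Longrightarrow> c v \<in> B - Lf \<and> adj v (c v)"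
    and centre: "\<And>v. v \<in> B - Lf \<Longrightarrow> c v = v"
    and indep: "\<And>u v. u \<in> Lf \<Longrightarrow> v \<in> Lf \<Longrightarrow> c u = c v \<Longrightarrow> \<not> adj u v"
    and h: "\<And>v. v \<in> B \<Longrightarrow> h v = (if v \<in> Lf then - 1 else 1)"
  shows "(\<Sum>u\<in>B. \<Sum>v | v \<in> B \<and> c v = c u. wt u v * h u * h v) \<le> - 2 * real (card Lf)"
proof -
  \<comment> \<open>Marks the pairs of a leaf and its centre, the only edges inside a cluster. Each
    is cut and counted in both orders, which gives the factor 2.\<close>
  define i where "i u v = (if u \<in> Lf \<and> v = c u then 1 else 0 :: real)" for u v
  have "(\<Sum>u\<in>B. \<Sum>v | v \<in> B \<and> c v = c u. wt u v * h u * h v)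
      \<le> (\<Sum>u\<in>B. \<Sum>v | v \<in> B \<and> c v = c u. - i u v - i v u)"
  proof (intro sum_mono)
    fix u v assume u: "u \<in> B" and "v \<in> {v. v \<in> B \<and> c v = c u}"
    then have v: "v \<in> B" "c v = c u"
      by auto
    show "wt u v * h u * h v \<le> - i u v - i v u"
    proof (cases "u \<in> Lf"; cases "v \<in> Lf")
      assume "u \<in> Lf" "v \<in> Lf"
      then show ?thesis
        using indep[of u v] leaf[of u] leaf[of v] v by (auto simp: i_def wt_def)
    next
      assume "u \<in> Lf" "v \<notin> Lf"
      then show ?thesis
        using leaf[of u] centre[of v] v u h by (auto simp: i_def wt_def)
    next
      assume "u \<notin> Lf" "v \<in> Lf"
      then show ?thesis
        using leaf[of v] centre[of u] v u h adj_sym by (auto simp: i_def wt_def)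
    next
      assume "u \<notin> Lf" "v \<notin> Lf"
      then show ?thesis
        using centre[of u] centre[of v] v u adj_irrefl by (auto simp: i_def wt_def)
    qed
  qed
  also have "\<dots> = - (\<Sum>u\<in>B. \<Sum>v | v \<in> B \<and> c v = c u. i u v) - (\<Sum>u\<in>B. \<Sum>v | v \<in> B \<and> c v = c u. i v u)"
    by (simp add: sum_subtractf sum_negf)
  also have "(\<Sum>u\<in>B. \<Sum>v | v \<in> B \<and> c v = c u. i v u) = (\<Sum>v\<in>B. \<Sum>u | u \<in> B \<and> c v = c u. i v u)"
    using assms(1) by (subst sum.swap_restrict) auto
  also have "\<dots> = (\<Sum>u\<in>B. \<Sum>v | v \<in> B \<and> c v = c u. i u v)"
    by (simp add: eq_commute)
  also have "\<dots> = (\<Sum>u\<in>B. if u \<in> Lf then 1 else 0)"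
  proof (intro sum.cong refl)
    fix u assume u: "u \<in> B"
    show "(\<Sum>v | v \<in> B \<and> c v = c u. i u v) = (if u \<in> Lf then 1 else 0)"
    proof (cases "u \<in> Lf")
      case True
      then have "c u \<in> {v. v \<in> B \<and> c v = c u}"
        using leaf[of u] centre[of "c u"] by auto
      then show ?thesis
        using True assms(1) by (simp add: i_def sum.delta)
    qed (simp add: i_def)
  qed
  also have "\<dots> = real (card Lf)"
    using assms(1) Lf by (simp add: sum.If_cases Int_absorb1)
  finally show ?thesis
    by simp
qed

text \<open>Vertices of degree above \<open>\<gamma> * N\<close> form \<open>A\<close>, whose size
  is bounded by the constant \<open>M\<close>, so edges inside \<open>A\<close> are negligible. A
  star has degree sum at most \<open>(1 + 1 / \<rho>) * (\<gamma> * N)\<close>, and \<gamma> makes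
  this \<open>\<rho> ^ 3 * N / 2\<close>.\<close>

lemma bisection_sparse:
  fixes \<delta> :: nat
  assumes \<delta>: "0 < \<delta>" "even \<delta>" and min_deg: "\<And>v. v \<in> V \<Longrightarrow> \<delta> \<le> vertex_degree E v"
    and \<rho>: "0 < \<rho>" "\<rho> \<le> 1 / 8" and n: "0 < card V" "card V \<le> card E"
    and large: "2 \<le> \<rho> ^ 3 * real (card V)"
    and \<gamma>: "\<gamma> = \<rho> ^ 3 / (2 * (1 + 1 / \<rho>))" and M: "M = 4 / (\<rho> ^ 3 * \<gamma>)"
    and MV: "M \<le> \<rho> * real (card V)" "M\<^sup>2 \<le> \<rho> * real (card V)"
    and sparse: "\<rho> ^ 3 * real (card E) \<le> 2 * real (card V)"
  shows "\<exists>V1 V2. bisection V V1 V2 \<and>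
    real (edges_within E V1) \<le> ((real \<delta> + 2) / (4 * (real \<delta> + 1)) + 19 * \<rho>) * real (card E) \<and>
    real (edges_within E V2) \<le> ((real \<delta> + 2) / (4 * (real \<delta> + 1)) + 19 * \<rho>) * real (card E)"
proof -
  define N m where "N = real (card V)" and "m = real (card E)"
  have pos: "0 < N" "0 < m" "N \<le> m"
    using n by (auto simp: N_def m_def)
  have \<gamma>_pos: "0 < \<gamma>"
    using \<rho> by (simp add: \<gamma> add_pos_pos)
  have \<gamma>_half: "\<gamma> \<le> \<rho> ^ 3 / 2"
    using \<rho> unfolding \<gamma> by (intro divide_left_mono) (auto intro: add_pos_pos)
  define B where "B = {v \<in> V. deg v \<le> \<gamma> * N}"
  define A where "A = V - B"
  have B: "B \<subseteq> V" "finite B" "finite A" "\<And>v. v \<in> B \<Longrightarrow> deg v \<le> \<gamma> * N"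
    using finite_vertices by (auto simp: B_def A_def)
  have cardA: "real (card A) \<le> M"
  proof -
    have "A = {v \<in> V. \<gamma> * N < deg v}"
      by (auto simp: A_def B_def)
    then have "\<gamma> * N * real (card A) \<le> 2 * m"
      using card_high_degree[of "\<gamma> * N"] \<gamma>_pos pos by (simp add: m_def)
    then have "\<rho> ^ 3 * (\<gamma> * N * real (card A)) \<le> \<rho> ^ 3 * (2 * m)"
      using \<rho> by (intro mult_left_mono) auto
    also have "\<dots> \<le> 4 * N"
      using sparse unfolding m_def N_def by linarith
    finally have "N * (\<rho> ^ 3 * \<gamma> * real (card A)) \<le> N * 4"
      by (simp add: algebra_simps)
    then have "\<rho> ^ 3 * \<gamma> * real (card A) \<le> 4"
      using pos by simp
    then show ?thesis
      using \<rho> \<gamma>_pos by (simp add: M field_simps)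
  qed
  have A_lin: "real (card A) \<le> \<rho> * N"
    using cardA MV by (simp add: N_def)
  have A_sq: "(real (card A))\<^sup>2 \<le> \<rho> * m"
  proof -
    have "(real (card A))\<^sup>2 \<le> M\<^sup>2"
      using cardA by (intro power_mono) auto
    also have "\<dots> \<le> \<rho> * N"
      using MV by (simp add: N_def)
    also have "\<dots> \<le> \<rho> * m"
      using pos \<rho> by simp
    finally show ?thesis .
  qed
  have wtA: "(\<Sum>u\<in>A. \<Sum>v\<in>A. wt u v) \<le> (real (card A))\<^sup>2"
  proof -
    have "(\<Sum>u\<in>A. \<Sum>v\<in>A. wt u v) \<le> (\<Sum>u\<in>A. \<Sum>v\<in>A. 1)"
      by (intro sum_mono) (simp add: wt_def)
    then show ?thesis
      by (simp add: power2_eq_square)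
  qed

  define w where "w a = (\<Sum>v\<in>B. wt a v)" for a
  have w: "0 \<le> w a \<and> w a \<le> real (card B)" for a
    using B(2) by (auto simp: w_def sum_wt intro: card_mono)
  obtain s \<theta> where s_all: "\<forall>a. s a = 1 \<or> s a = - 1" and \<theta>: "\<theta> = \<bar>\<Sum>a\<in>A. s a * w a\<bar>"
    and \<theta>_alt: "\<theta> \<le> real (card B) / 2 \<or>
      (\<exists>L\<subseteq>A. odd (card L) \<and> (\<forall>a\<in>L. \<theta> \<le> w a) \<and> \<theta> + sum w (A - L) \<le> real (card B))"
    using minimal_signs[of A w "real (card B)", OF B(3) w of_nat_0_le_iff]
    by (elim exE conjE) (assumption | rule that)+
  have s: "s a = 1 \<or> s a = - 1" for a
    using s_all by (rule spec)

  obtain c0 Z where Z: "Z \<subseteq> B"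
    and c0_all: "\<forall>v\<in>B. c0 v \<in> B \<and> c0 (c0 v) = c0 v \<and> (c0 v \<noteq> v \<longrightarrow> adj v (c0 v))"
    and indep_all: "\<forall>u\<in>B. \<forall>v\<in>B. c0 u = c0 v \<and> c0 u \<noteq> u \<and> c0 v \<noteq> v \<longrightarrow> \<not> adj u v"
    and cardB: "card B \<le> card Z + 2 * card {v \<in> B. c0 v \<noteq> v}"
    and disj_all: "\<forall>z\<in>Z. \<forall>z'\<in>Z. z \<noteq> z' \<longrightarrow>
      insert z {v \<in> B. adj z v} \<inter> insert z' {v \<in> B. adj z' v} = {}"
    and even_all: "\<forall>z\<in>Z. \<forall>w \<in> insert z {v \<in> B. adj z v}. even (card {v \<in> B. adj w v})"
    using star_partition[OF B(2) symp_adj irreflp_adj]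
    by (elim exE conjE) (assumption | rule that)+
  have c0: "c0 v \<in> B \<and> c0 (c0 v) = c0 v \<and> (c0 v \<noteq> v \<longrightarrow> adj v (c0 v))" if "v \<in> B" for v
    using c0_all that by (rule bspec)
  have indep: "\<not> adj u v" if "u \<in> B" "v \<in> B" "c0 u = c0 v" "c0 u \<noteq> u" "c0 v \<noteq> v" for u v
    using indep_all that by simp
  have disj: "insert z {v \<in> B. adj z v} \<inter> insert z' {v \<in> B. adj z' v} = {}"
    if "z \<in> Z" "z' \<in> Z" "z \<noteq> z'" for z z'
    using disj_all that by blast
  have even: "even (card {v \<in> B. adj w v})" if "z \<in> Z" "w \<in> insert z {v \<in> B. adj z v}" for z w
    using even_all that by blast
  have key: "2 * (real \<delta> + 1) * \<theta> \<le> 2 * m + (real \<delta> + 1) * (real (card B) - real (card Z))"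
    unfolding m_def using \<theta>_alt
    by (intro key_inequality[OF \<delta> min_deg B(1) Z disj even]) (auto simp: \<theta> A_def w_def)

  text \<open>Leaves of large degree are dropped, so that no cluster has a large sum of degrees.\<close>
  define Lf where "Lf = {v \<in> B. c0 v \<noteq> v \<and> deg v \<le> 1 / \<rho>}"
  define c where "c v = (if v \<in> Lf then c0 v else v)" for v
  define h where "h v = (if v \<in> A then s v else if v \<in> Lf then - 1 else 1)" for v
  \<comment> \<open>\<open>None\<close> merges all of \<open>A\<close> into one cluster, apart from
    the stars.\<close>
  define c' where "c' v = (if v \<in> B then Some (c v) else None)" for v
  have Lf: "Lf \<subseteq> B" "finite Lf"
    using B by (auto simp: Lf_def)
  have leaf: "c v \<in> B - Lf \<and> adj v (c v)" if "v \<in> Lf" for v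
    using that c0[of v] by (auto simp: Lf_def c_def)
  have cB: "c v \<in> B" if "v \<in> B" for v
    using that leaf[of v] by (cases "v \<in> Lf") (auto simp: c_def)
  have cluster_leaves: "real (card {v \<in> Lf. c v = k}) \<le> \<gamma> * N" if "k \<in> B" for k
  proof -
    have "card {v \<in> Lf. c v = k} \<le> card {v \<in> V. adj k v}"
      using leaf adj_sym Lf B finite_vertices by (intro card_mono) auto
    then show ?thesis
      using B(4)[OF that] by (simp add: deg_def vertex_degree_eq)
  qed
  have cluster: "{v. v \<in> B \<and> c v = k} \<subseteq> insert k {v \<in> Lf. c v = k}" for k
    by (auto simp: c_def)
  \<comment> \<open>The dropped leaves have degree above \<open>1 / \<rho>\<close>, so Markov's
    inequality leaves at most \<open>2 * \<rho> * m\<close> of them.\<close>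
  have leaf_count: "(real (card B) - real (card Z)) / 2 \<le> real (card Lf) + 2 * \<rho> * m"
  proof -
    have "{v \<in> B. c0 v \<noteq> v} \<subseteq> Lf \<union> {v \<in> V. 1 / \<rho> < deg v}"
      using B by (auto simp: Lf_def)
    then have "card {v \<in> B. c0 v \<noteq> v} \<le> card Lf + card {v \<in> V. 1 / \<rho> < deg v}"
      using Lf finite_vertices by (intro order_trans[OF card_mono card_Un_le]) auto
    moreover have "real (card {v \<in> V. 1 / \<rho> < deg v}) \<le> 2 * \<rho> * m"
      using card_high_degree[of "1 / \<rho>"] \<rho> by (simp add: m_def field_simps)
    moreover have "real (card B) \<le> real (card Z) + 2 * real (card {v \<in> B. c0 v \<noteq> v})"
      using cardB by linarith
    ultimately show ?thesis
      by (simp flip: of_nat_le_iff[where 'a = real])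
  qed

  have cut: "(\<Sum>u\<in>V. \<Sum>v | v \<in> V \<and> c' v = c' u. wt u v * h u * h v)
      \<le> (real (card A))\<^sup>2 - 2 * real (card Lf)"
  proof -
    have "(\<Sum>u\<in>V. \<Sum>v | v \<in> V \<and> c' v = c' u. wt u v * h u * h v)
        = (\<Sum>u\<in>A. \<Sum>v | v \<in> V \<and> c' v = c' u. wt u v * h u * h v)
          + (\<Sum>u\<in>B. \<Sum>v | v \<in> V \<and> c' v = c' u. wt u v * h u * h v)"
      unfolding A_def using B finite_vertices by (intro sum.subset_diff) auto
    also have "(\<Sum>u\<in>A. \<Sum>v | v \<in> V \<and> c' v = c' u. wt u v * h u * h v)
        = (\<Sum>u\<in>A. \<Sum>v\<in>A. wt u v * h u * h v)"
      by (intro sum.cong refl) (auto simp: c'_def A_def)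
    also have "\<dots> \<le> (\<Sum>u\<in>A. \<Sum>v\<in>A. wt u v)"
    proof (intro sum_mono)
      fix u v
      show "wt u v * h u * h v \<le> wt u v"
        using s[of u] s[of v] wt_nonneg[of u v] by (auto simp: h_def)
    qed
    also have "(\<Sum>u\<in>B. \<Sum>v | v \<in> V \<and> c' v = c' u. wt u v * h u * h v)
        = (\<Sum>u\<in>B. \<Sum>v | v \<in> B \<and> c v = c u. wt u v * h u * h v)"
      using B(1) by (intro sum.cong refl) (auto simp: c'_def split: if_splits)
    also have "\<dots> \<le> - 2 * real (card Lf)"
    proof (rule star_clusters_cut[OF B(2) Lf(1) leaf])
      show "\<not> adj u v" if "u \<in> Lf" "v \<in> Lf" "c u = c v" for u v
        using that indep[of u v] by (auto simp: Lf_def c_def)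
    qed (auto simp: c_def h_def A_def)
    finally show ?thesis
      using wtA by simp
  qed
  have SA: "\<bar>\<Sum>v\<in>A. deg v * h v\<bar> \<le> \<theta> + (real (card A))\<^sup>2"
  proof -
    have "deg v = w v + (\<Sum>u\<in>A. wt v u)" for v
      unfolding deg_eq w_def A_def using B(1) finite_vertices
      by (subst sum.subset_diff[OF B(1)]) auto
    then have "(\<Sum>v\<in>A. deg v * h v) = (\<Sum>v\<in>A. s v * w v) + (\<Sum>v\<in>A. \<Sum>u\<in>A. s v * wt v u)"
      by (simp add: h_def algebra_simps sum.distrib sum_distrib_left)
    moreover have "\<bar>\<Sum>v\<in>A. \<Sum>u\<in>A. s v * wt v u\<bar> \<le> (\<Sum>v\<in>A. \<Sum>u\<in>A. wt v u)"
    proof -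
      have "\<bar>s v * wt v u\<bar> = wt v u" for u v
        using s[of v] wt_nonneg[of v u] by auto
      then show ?thesis
        by (intro order_trans[OF sum_abs] sum_mono order_trans[OF sum_abs]) auto
    qed
    ultimately show ?thesis
      using wtA \<theta> by linarith
  qed

  have "\<exists>V1 V2. bisection V V1 V2 \<and>
    real (edges_within E V1) \<le> ((real \<delta> + 2) / (4 * (real \<delta> + 1)) + 2 * \<rho>) * m + 17 * \<rho> * real (card E) \<and>
    real (edges_within E V2) \<le> ((real \<delta> + 2) / (4 * (real \<delta> + 1)) + 2 * \<rho>) * m + 17 * \<rho> * real (card E)"
  proof (rule bisection_of_clusters[where B = B and c = c' and h = h, OF B(1) _ \<rho> n(1)])
    have same: "{v. v \<in> B \<and> c' v = c' u} = {v. v \<in> B \<and> c v = c u}" if "u \<in> B" for u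
      using that by (auto simp: c'_def)
    have "(\<Sum>u\<in>B. \<Sum>v | v \<in> B \<and> c' v = c' u. deg u * deg v)
        = (\<Sum>u\<in>B. deg u * (\<Sum>v | v \<in> B \<and> c v = c u. deg v))"
      by (intro sum.cong refl) (simp only: same sum_distrib_left)
    also have "\<dots> \<le> (\<Sum>u\<in>B. deg u * ((1 + 1 / \<rho>) * (\<gamma> * N)))"
    proof (intro sum_mono mult_left_mono)
      fix u assume u: "u \<in> B"
      have "(\<Sum>v | v \<in> B \<and> c v = c u. deg v) \<le> (\<Sum>v\<in>insert (c u) {v \<in> Lf. c v = c u}. deg v)"
        using cluster[of "c u"] Lf by (intro sum_mono2) (auto simp: deg_nonneg)
      also have "\<dots> \<le> deg (c u) + (\<Sum>v | v \<in> Lf \<and> c v = c u. deg v)"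
        using Lf deg_nonneg by (simp add: sum.insert_if)
      also have "(\<Sum>v | v \<in> Lf \<and> c v = c u. deg v) \<le> (\<Sum>v | v \<in> Lf \<and> c v = c u. 1 / \<rho>)"
        by (intro sum_mono) (auto simp: Lf_def)
      also have "\<dots> = 1 / \<rho> * real (card {v \<in> Lf. c v = c u})"
        by simp
      also have "\<dots> \<le> 1 / \<rho> * (\<gamma> * N)"
        using cluster_leaves[OF cB[OF u]] \<rho> by (intro mult_left_mono) auto
      finally show "(\<Sum>v | v \<in> B \<and> c v = c u. deg v) \<le> (1 + 1 / \<rho>) * (\<gamma> * N)"
        using B(4)[OF cB[OF u]] by (simp add: algebra_simps)
    qed (rule deg_nonneg)
    also have "\<dots> = (\<Sum>u\<in>B. deg u) * ((1 + 1 / \<rho>) * (\<gamma> * N))"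
      by (rule sum_distrib_right[symmetric])
    also have "(1 + 1 / \<rho>) * (\<gamma> * N) = \<rho> ^ 3 * N / 2"
    proof -
      have "1 + 1 / \<rho> \<noteq> 0"
        using \<rho> by (simp add: add_pos_pos less_imp_neq[THEN not_sym])
      moreover have "k * (\<rho> ^ 3 / (2 * k) * N) = \<rho> ^ 3 * N / 2" if "k \<noteq> 0" for k
        using that by simp
      ultimately show ?thesis
        unfolding \<gamma> by blast
    qed
    also have "(\<Sum>u\<in>B. deg u) * (\<rho> ^ 3 * N / 2) \<le> (\<Sum>u\<in>V. deg u) * (\<rho> ^ 3 * N / 2)"
      using B finite_vertices pos \<rho> by (intro mult_right_mono sum_mono2) (auto simp: deg_nonneg)
    also have "\<dots> = \<rho> ^ 3 * m * N"
      by (simp add: sum_deg m_def)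
    also have "\<dots> \<le> \<rho> ^ 3 * m * m"
      using pos \<rho> by (intro mult_left_mono) auto
    finally show "(\<Sum>u\<in>B. \<Sum>v | v \<in> B \<and> c' v = c' u. deg u * deg v) \<le> \<rho> ^ 3 * real (card E) ^ 2"
      by (simp add: m_def power2_eq_square mult.assoc)
    have "(\<Sum>u\<in>B. real (card {v \<in> B. c' v = c' u})) \<le> (\<Sum>u\<in>B. \<rho> ^ 3 * N)"
    proof (intro sum_mono)
      fix u assume u: "u \<in> B"
      have "card {v. v \<in> B \<and> c v = c u} \<le> card (insert (c u) {v \<in> Lf. c v = c u})"
        using cluster[of "c u"] Lf by (intro card_mono) auto
      also have "\<dots> \<le> Suc (card {v \<in> Lf. c v = c u})"
        using Lf by (simp add: card_insert_if)
      finally have "real (card {v. v \<in> B \<and> c v = c u}) \<le> 1 + \<gamma> * N"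
        using cluster_leaves[OF cB[OF u]] by linarith
      moreover have "\<gamma> * N \<le> \<rho> ^ 3 / 2 * N"
        using \<gamma>_half pos by (intro mult_right_mono) auto
      ultimately show "real (card {v \<in> B. c' v = c' u}) \<le> \<rho> ^ 3 * N"
        unfolding same[OF u] using large by (simp add: N_def)
    qed
    also have "\<dots> = \<rho> ^ 3 * N * real (card B)"
      by simp
    also have "\<dots> \<le> \<rho> ^ 3 * N * N"
      using \<rho> pos B(1) finite_vertices unfolding N_def by (intro mult_left_mono) (auto intro: card_mono)
    finally show "(\<Sum>u\<in>B. real (card {v \<in> B. c' v = c' u})) \<le> \<rho> ^ 3 * real (card V) ^ 2"
      by (simp add: N_def power2_eq_square mult.assoc)
    show "real (card (V - B)) \<le> \<rho> * real (card V)"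
      using A_lin by (simp add: A_def N_def)
    \<comment> \<open>This is \<open>key\<close> divided by \<open>8 * (\<delta> + 1)\<close>; the
      last term is cancelled by the cut edges of the stars. Edges inside \<open>A\<close> and
      dropped leaves fit into \<open>2 * \<rho> * m\<close>.\<close>
    have "\<theta> / 4 \<le> m / (4 * (real \<delta> + 1)) + (real (card B) - real (card Z)) / 8"
      using key by (simp add: field_simps)
    moreover have "(real \<delta> + 2) / (4 * (real \<delta> + 1)) * m = m / 4 + m / (4 * (real \<delta> + 1))"
      by (simp add: field_simps)
    moreover have "0 \<le> \<rho> * m"
      using \<rho> pos by simp
    ultimately show "real (card E) / 4 + \<bar>\<Sum>v\<in>V - B. deg v * h v\<bar> / 4
        + (\<Sum>u\<in>V. \<Sum>v | v \<in> V \<and> c' v = c' u. wt u v * h u * h v) / 8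
        \<le> ((real \<delta> + 2) / (4 * (real \<delta> + 1)) + 2 * \<rho>) * m"
      using cut SA A_sq leaf_count unfolding A_def[symmetric] distrib_right m_def[symmetric] by linarith
  qed (use s n in \<open>auto simp: h_def c'_def\<close>)
  then show ?thesis
    by (simp add: m_def algebra_simps)
qed

end

section \<open>Choice of constants and the split into dense and sparse graphs\<close>

theorem theorem1p9:
  fixes \<epsilon> :: real and \<delta> :: nat
  assumes "0 < \<epsilon>" and "0 < \<delta>" and "even \<delta>"
  shows "\<exists>n0 :: nat. \<forall>(V :: 'a set) (E :: 'a set set).
           simple_graph V E \<longrightarrow> n0 \<le> card V \<longrightarrow> \<delta> \<le> min_degree V E \<longrightarrow>
           (\<exists>V1 V2. bisection V V1 V2 \<and>
              real (edges_within E V1)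
                \<le> ((real \<delta> + 2) / (4 * (real \<delta> + 1)) + \<epsilon>) * real (card E) \<and>
              real (edges_within E V2)
                \<le> ((real \<delta> + 2) / (4 * (real \<delta> + 1)) + \<epsilon>) * real (card E))"
proof -
  \<comment> \<open>The cap \<open>1 / 8\<close> keeps the imbalance \<open>4 * \<rho>\<close>
    within the reach of \<open>rebalance\<close>; \<open>19 = 17 + 2\<close> adds the losses of the
    sparse case.\<close>
  define \<rho> where "\<rho> = min (1 / 8) (\<epsilon> / 19)"
  have \<rho>: "0 < \<rho>" "\<rho> \<le> 1 / 8" "19 * \<rho> \<le> \<epsilon>"
    using assms by (auto simp: \<rho>_def)
  define \<gamma> where "\<gamma> = \<rho> ^ 3 / (2 * (1 + 1 / \<rho>))"
  define M where "M = 4 / (\<rho> ^ 3 * \<gamma>)"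
  \<comment> \<open>One summand for each lower bound on \<open>card V\<close>; the final
    \<open>1\<close> makes \<open>V\<close> nonempty, so that the minimum degree is
    meaningful.\<close>
  define n0 where "n0 = nat \<lceil>2 / \<rho> ^ 3\<rceil> + nat \<lceil>M / \<rho>\<rceil> + nat \<lceil>M\<^sup>2 / \<rho>\<rceil> + 1"
  show ?thesis
  proof (intro exI[of _ n0] allI impI)
    fix V :: "'a set" and E :: "'a set set"
    assume "simple_graph V E" and n0: "n0 \<le> card V" and min: "\<delta> \<le> min_degree V E"
    then interpret simple_graph V E
      by simp
    have n: "0 < card V"
      using n0 by (simp add: n0_def)
    have min_deg: "\<delta> \<le> vertex_degree E v" if "v \<in> V" for v
      using min that finite_vertices unfolding min_degree_def by (auto intro: order_trans[OF _ Min_le])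
    have "2 \<le> \<delta>"
      using assms by (auto elim!: evenE)
    then have nE: "card V \<le> card E"
      using min_deg by (intro card_vertices_le) fastforce
    have "2 / \<rho> ^ 3 \<le> real (card V)" "M / \<rho> \<le> real (card V)" "M\<^sup>2 / \<rho> \<le> real (card V)"
      using n0 unfolding n0_def by linarith+
    then have large: "2 \<le> \<rho> ^ 3 * real (card V)" "M \<le> \<rho> * real (card V)" "M\<^sup>2 \<le> \<rho> * real (card V)"
      using \<rho> by (simp_all add: field_simps)
    let ?r = "(real \<delta> + 2) / (4 * (real \<delta> + 1))"
    have "\<exists>V1 V2. bisection V V1 V2 \<and>
      real (edges_within E V1) \<le> (?r + 19 * \<rho>) * real (card E) \<and>
      real (edges_within E V2) \<le> (?r + 19 * \<rho>) * real (card E)"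
    proof (cases "2 * real (card V) \<le> \<rho> ^ 3 * real (card E)")
      case True
      have "1 / 4 \<le> ?r"
        by (simp add: field_simps)
      then have "1 / 4 + 17 * \<rho> \<le> ?r + 19 * \<rho>"
        using \<rho> by linarith
      then have "(1 / 4 + 17 * \<rho>) * real (card E) \<le> (?r + 19 * \<rho>) * real (card E)"
        by (rule mult_right_mono) simp
      moreover have "0 < card E" "1 \<le> \<rho> ^ 3 * real (card V)"
        using n nE large(1) by linarith+
      ultimately show ?thesis
        using bisection_dense[OF \<rho>(1,2) n _ _ True] unfolding distrib_right[of "1 / 4"]
        by (simp only: mult_1 times_divide_eq_left) (meson order_trans)
    next
      case False
      then show ?thesis
        using bisection_sparse[OF assms(2,3) min_deg \<rho>(1,2) n nE large(1) \<gamma>_def M_def large(2,3)] by simp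
    qed
    moreover have "(?r + 19 * \<rho>) * real (card E) \<le> (?r + \<epsilon>) * real (card E)"
      using \<rho>(3) by (intro mult_right_mono) auto
    ultimately show "\<exists>V1 V2. bisection V V1 V2 \<and>
      real (edges_within E V1) \<le> (?r + \<epsilon>) * real (card E) \<and>
      real (edges_within E V2) \<le> (?r + \<epsilon>) * real (card E)"
      by (meson order_trans)
  qed
qed

end
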